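(* Let $L>0$, $\rho\in\mathbb R$, let $(\lambda_n)_{n\ge1}$ be the increasingly ordered Dirichlet eigenvalues of the random operator $H_\omega=-\frac{d^2}{dx^2}+\rho\dot B_x(\omega)$ on $(0,L)$, and put $k_n=\sqrt{\max\{\lambda_n,0\}}$. Then for every $\varepsilon>0$, $$k_n=\frac{n\pi}{L}+O(n^{-1+\varepsilon})\qquad\text{almost surely}.$$ Consequently, for every $\varepsilon>0$, $$\lambda_n=\Big(\frac{n\pi}{L}\Big)^2+O(n^{\varepsilon})\qquad\text{almost surely}.$$
   Context: Setting. $(\Omega,\mathcal F,\mathbb P)$ is a probability space carrying a standard Brownian motion $B=(B_x)_{0\le x\le L}$ with $B_0=0$; $L>0$ and $\rho\in\mathbb R$ are fixed. Operator. For $\omega$ outside a null set put $\sigma_\omega(x)=\rho B_x(\omega)$, a continuous function on $[0,L]$. For a function $y$ define the quasi-derivative $y^{[1]}=y'-\sigma_\omega y$ and $\ell_{\sigma_\omega}y=-(y^{[1]})'-\sigma_\omega y^{[1]}-\sigma_\omega^2y$ (this is the rigorous meaning of $-y''+\rho\dot B\,y$). The Dirichlet operator $H_\omega$ in $L^2(0,L)$ is $H_\omega y=\ell_{\sigma_\omega}y$ with domain $\{y\in L^2(0,L): y,y^{[1]}\in AC[0,L],\ \ell_{\sigma_\omega}y\in L^2(0,L),\ y(0)=y(L)=0\}$. It is self-adjoint, bounded from below, with compact resolvent and simple eigenvalues; its eigenvalues, listed increasingly, are $\lambda_1(\omega)<\lambda_2(\omega)<\cdots\to+\infty$. Notation.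 "$X_n=Y_n+O(a_n)$ almost surely" means that for almost every $\omega$ there are finite $C(\omega)$ and $N(\omega)$ with $|X_n(\omega)-Y_n(\omega)|\le C(\omega)a_n$ for all $n\ge N(\omega)$. *)

theory Defs
  imports "HOL-Probability.Probability" "HOL-Library.Landau_Symbols"
begin

definition standard_brownian_motion_on ::
    "'a measure \<Rightarrow> real \<Rightarrow> (real \<Rightarrow> 'a \<Rightarrow> real) \<Rightarrow> bool" where
  "standard_brownian_motion_on M L B \<longleftrightarrow>
     prob_space M \<and>
     (\<forall>x\<in>{0..L}. B x \<in> borel_measurable M) \<and>
     (AE \<omega> in M. B 0 \<omega> = 0) \<and>
     (\<forall>s t. 0 \<le> s \<and> s < t \<and> t \<le> L \<longrightarrow>
        distributed M lborel (\<lambda>\<omega>. B t \<omega> - B s \<omega>)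
          (\<lambda>z. ennreal (normal_density 0 (sqrt (t - s)) z))) \<and>
     (\<forall>(n::nat) t. (\<forall>i\<le>n. t i \<in> {0..L}) \<and> (\<forall>i<n. t i \<le> t (Suc i)) \<longrightarrow>
        prob_space.indep_vars M (\<lambda>_. borel) (\<lambda>i \<omega>. B (t (Suc i)) \<omega> - B (t i) \<omega>) {..<n}) \<and>
     (AE \<omega> in M. continuous_on {0..L} (\<lambda>x. B x \<omega>))"

definition absolutely_continuous_on :: "real \<Rightarrow> real \<Rightarrow> (real \<Rightarrow> complex) \<Rightarrow> bool" where
  "absolutely_continuous_on a b f \<longleftrightarrow>
     (\<forall>e>0. \<exists>d>0. \<forall>I. finite I \<and> (\<forall>(u, v)\<in>I. a \<le> u \<and> u \<le> v \<and> v \<le> b) \<and>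
          disjoint_family_on (\<lambda>(u, v). {u<..<v}) I \<and> (\<Sum>(u, v)\<in>I. v - u) < d
        \<longrightarrow> (\<Sum>(u, v)\<in>I. norm (f v - f u)) < e)"

definition square_integrable_on :: "real \<Rightarrow> (real \<Rightarrow> complex) \<Rightarrow> bool" where
  "square_integrable_on L f \<longleftrightarrow>
     f \<in> borel_measurable (lebesgue_on {0<..<L}) \<and>
     integrable (lebesgue_on {0<..<L}) (\<lambda>x. (norm (f x))\<^sup>2)"

text \<open>The quasi-derivative \<open>y\<^sup>[\<^sup>1\<^sup>] = y' - \<sigma> y\<close> is an almost-everywhere defined function, so that
  \<open>y\<^sup>[\<^sup>1\<^sup>] \<in> AC[0,L]\<close> means that it has an absolutely continuous representative \<open>u\<close>
  (necessarily unique on \<open>[0,L]\<close>). The derivative condition is \<open>u = y' - \<sigma> y\<close> solved for \<open>y'\<close>.\<close>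

definition has_ac_quasi_derivative ::
    "real \<Rightarrow> (real \<Rightarrow> real) \<Rightarrow> (real \<Rightarrow> complex) \<Rightarrow> (real \<Rightarrow> complex) \<Rightarrow> bool" where
  "has_ac_quasi_derivative L \<sigma> y u \<longleftrightarrow>
     absolutely_continuous_on 0 L u \<and>
     (AE x in lebesgue_on {0<..<L}.
        (y has_vector_derivative (u x + of_real (\<sigma> x) * y x)) (at x))"

text \<open>\<open>f = - (y\<^sup>[\<^sup>1\<^sup>])' - \<sigma> y\<^sup>[\<^sup>1\<^sup>] - \<sigma>\<^sup>2 y\<close> almost everywhere, where \<open>u\<close> represents \<open>y\<^sup>[\<^sup>1\<^sup>]\<close>.\<close>

definition is_quasi_expression ::
    "real \<Rightarrow> (real \<Rightarrow> real) \<Rightarrow> (real \<Rightarrow> complex) \<Rightarrow> (real \<Rightarrow> complex) \<Rightarrow> (real \<Rightarrow> complex) \<Rightarrow> bool"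
  where
  "is_quasi_expression L \<sigma> y u f \<longleftrightarrow>
     (AE x in lebesgue_on {0<..<L}. \<exists>u'. (u has_vector_derivative u') (at x) \<and>
        f x = - u' - of_real (\<sigma> x) * u x - (of_real (\<sigma> x))\<^sup>2 * y x)"

text \<open>The graph of the Dirichlet operator; elements of \<open>L\<^sup>2(0,L)\<close> are represented by functions, an
  element of the domain by its absolutely continuous representative \<open>y\<close> and its image by any
  function \<open>f\<close> in the class.\<close>

definition dirichlet_operator ::
    "real \<Rightarrow> (real \<Rightarrow> real) \<Rightarrow> ((real \<Rightarrow> complex) \<times> (real \<Rightarrow> complex)) set" where
  "dirichlet_operator L \<sigma> =
     {(y, f). square_integrable_on L y \<and> absolutely_continuous_on 0 L y \<and>
        (\<exists>u. has_ac_quasi_derivative L \<sigma> y u \<and> is_quasi_expression L \<sigma> y u f) \<and>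
        square_integrable_on L f \<and> y 0 = 0 \<and> y L = 0}"

definition dirichlet_eigenvalues :: "real \<Rightarrow> (real \<Rightarrow> real) \<Rightarrow> real set" where
  "dirichlet_eigenvalues L \<sigma> =
     {\<mu>. \<exists>(y, f)\<in>dirichlet_operator L \<sigma>.
        \<not> (AE x in lebesgue_on {0<..<L}. y x = 0) \<and>
        (AE x in lebesgue_on {0<..<L}. f x = of_real \<mu> * y x)}"

definition nth_smallest :: "real set \<Rightarrow> nat \<Rightarrow> real" where
  "nth_smallest S n = (THE \<mu>. \<mu> \<in> S \<and> card {\<nu>\<in>S. \<nu> \<le> \<mu>} = n)"

text \<open>Counting starts at \<open>n = 1\<close>; on a set listed increasingly, \<open>nth_smallest\<close> returns the
  listing.\<close>

lemma nth_smallest_eq: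
  assumes mono: "strict_mono_on {1..} l" and S: "S = l ` {1..}" and n: "n \<ge> 1"
  shows "nth_smallest S n = l n"
proof -
  have card: "card {\<nu>\<in>S. \<nu> \<le> l m} = m" if "m \<ge> 1" for m
  proof -
    have "{\<nu>\<in>S. \<nu> \<le> l m} = l ` {1..m}"
      using that strict_mono_on_less_eq[OF mono] unfolding S by auto
    moreover have "inj_on l {1..m}"
      using strict_mono_on_imp_inj_on[OF mono] by (rule inj_on_subset) auto
    ultimately show ?thesis by (simp add: card_image)
  qed
  show ?thesis
    unfolding nth_smallest_def
  proof (rule the_equality)
    show "l n \<in> S \<and> card {\<nu>\<in>S. \<nu> \<le> l n} = n" using n card S by auto
  next
    fix \<mu> assume "\<mu> \<in> S \<and> card {\<nu>\<in>S. \<nu> \<le> \<mu>} = n"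
    then show "\<mu> = l n" using card S by auto
  qed
qed

text \<open>The \<open>n\<close>-th eigenvalue (\<open>n \<ge> 1\<close>) of \<open>- d\<^sup>2/dx\<^sup>2 + \<sigma>'\<close> on \<open>(0,L)\<close>. The eigenvalues are simple,
  so that no multiplicities enter.\<close>

definition dirichlet_eigenvalue :: "real \<Rightarrow> (real \<Rightarrow> real) \<Rightarrow> nat \<Rightarrow> real" where
  "dirichlet_eigenvalue L \<sigma> n = nth_smallest (dirichlet_eigenvalues L \<sigma>) n"

end

theory Submission
  imports Defs "HOL-Real_Asymp.Real_Asymp"
begin

text \<open>
  Fix a continuous path \<open>\<sigma>\<close> (later \<open>\<rho>\<close> times a Brownian path) and let \<open>y\<close>, \<open>u\<close> solve
  \<open>y' = u + \<sigma> y\<close>, \<open>u' = - \<sigma> u - (\<sigma>\<^sup>2 + \<mu>) y\<close>, the eigenvalue equation written with the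
  quasi-derivative \<open>u\<close>. In polar coordinates \<open>y = r sin \<theta>\<close>, \<open>u = r cos \<theta>\<close> the angle satisfies
  \<open>\<theta>' = (cos \<theta> + \<sigma> sin \<theta>)\<^sup>2 + \<mu> sin\<^sup>2 \<theta>\<close>, an equation in which no derivative of \<open>\<sigma>\<close> occurs.
  With \<open>\<theta>(0) = 0\<close>, the number \<open>\<mu>\<close> is a Dirichlet eigenvalue iff \<open>\<theta>(L)\<close> is a multiple of \<open>\<pi>\<close>
  (\<open>dirichlet_eigenvalue_iff\<close>). The endpoint value \<open>\<theta>(L)\<close> is positive, continuous, strictly increasing
  and unbounded in \<open>\<mu>\<close>, and below \<open>\<pi>\<close> for very negative \<open>\<mu>\<close>; hence the \<open>n\<close>-th eigenvalue is the
  one number \<open>\<lambda>\<^sub>n\<close> at which \<open>\<theta>(L) = n \<pi>\<close> (\<open>enumeration_of_sine_zeros\<close>).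

  For \<open>\<mu> = k\<^sup>2\<close> the angle \<open>\<psi>\<close> with \<open>tan \<psi> = k tan \<theta>\<close> agrees with \<open>\<theta>\<close> at the multiples of \<open>\<pi>\<close> and
  satisfies \<open>\<psi>' = k + \<sigma> sin 2\<psi> + (\<sigma>\<^sup>2 / k) sin\<^sup>2 \<psi>\<close> (\<open>rescaled_prufer_angle\<close>). So \<open>\<psi>(L) = n \<pi>\<close> already
  puts \<open>k\<close> at a bounded distance from \<open>q = n \<pi> / L\<close>, and the finer estimate is a bound for
  \<open>\<integral> \<sigma> sin 2\<psi>\<close>. With \<open>\<phi> = \<psi> - q x\<close>, whose derivative is bounded, one expands
  \<open>sin 2\<psi> = sin 2qx cos 2\<phi> + cos 2qx sin 2\<phi>\<close> and integrates by parts: what remains is governed by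
  the integrals of \<open>\<sigma> sin 2qs\<close> and \<open>\<sigma> cos 2qs\<close> over \<open>[0,x]\<close>, uniformly in \<open>x\<close>
  (\<open>wave_number_estimate\<close>).

  The nonlinear angle has disappeared from these integrals. They are linear in the Brownian path, hence
  Gaussian, and their size follows from independence of the increments alone, with no
  stochastic integration: summation by parts turns a Riemann sum into a sum of independent
  increments with coefficients at most \<open>1/q\<close>, so that \<open>exp (q \<bar>\<integral>\<bar>)\<close> has expectation at most
  \<open>2 exp (L/2)\<close>. For each \<open>n\<close> it suffices to look at the \<open>n\<close> endpoints \<open>j L / n\<close>, and summing these
  expectations with weights \<open>1 / n\<^sup>3\<close> shows that almost surely all the integrals are
  \<open>O(log n / n)\<close> (\<open>brownian_oscillatory_integrals_AE\<close>). This gives \<open>k\<^sub>n = n \<pi> / L + O(log n / n)\<close> almost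
  surely, which contains both claims, since powers of \<open>n\<close> beat the logarithm.
\<close>

section \<open>Differential equations and inequalities on a closed interval\<close>

text \<open>Picard iteration, made to converge on the whole interval in one go: the unknown is the bounded
  continuous function \<open>exp (- 2 K x) \<theta> x\<close>, and with this weight the integral
  operator contracts the sup norm by the factor \<open>1/2\<close>. The functions live on the whole
  line, so the argument is clamped to \<open>[0,L]\<close>.\<close>

lemma initial_value_problem_has_solution:
  fixes F :: "real \<Rightarrow> real \<Rightarrow> real"
  assumes cont: "continuous_on ({0..L} \<times> UNIV) (\<lambda>(x, t). F x t)"
    and lip: "\<And>x s t. x \<in> {0..L} \<Longrightarrow> \<bar>F x s - F x t\<bar> \<le> K * \<bar>s - t\<bar>"
    and "K > 0" "L \<ge> 0"
  obtains \<theta> where "\<theta> 0 = 0"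
    "\<And>x. x \<in> {0..L} \<Longrightarrow> (\<theta> has_real_derivative F x (\<theta> x)) (at x within {0..L})"
proof -
  define cl where "cl x = max 0 (min L x)" for x :: real
  have cl: "cl x \<in> {0..L}" and cl_id: "x \<in> {0..L} \<Longrightarrow> cl x = x" for x
    using \<open>L \<ge> 0\<close> by (auto simp: cl_def)
  have cl_cont: "continuous_on UNIV cl"
    unfolding cl_def by (intro continuous_intros)
  define G where "G v s = F s (exp (2 * K * s) * apply_bcontfun v s)" for v :: "real \<Rightarrow>\<^sub>C real" and s
  have G_cont: "continuous_on {0..L} (G v)" for v
  proof -
    have "continuous_on {0..L} ((\<lambda>(x, t). F x t) \<circ> (\<lambda>s. (s, exp (2 * K * s) * apply_bcontfun v s)))"
      by (intro continuous_on_compose continuous_on_subset[OF cont] continuous_intros) auto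
    then show ?thesis by (simp add: G_def o_def)
  qed
  have G_int: "G v integrable_on {0..cl x}" for v x
    using cl[of x] by (intro integrable_continuous_real continuous_on_subset[OF G_cont]) auto
  define T where "T v x = exp (- (2 * K * cl x)) * integral {0..cl x} (G v)" for v x
  have I_cont: "continuous_on {0..L} (\<lambda>x. integral {0..x} (G v))" for v
    by (intro indefinite_integral_continuous_1 integrable_continuous_real G_cont)
  have T_cont: "continuous_on UNIV (T v)" for v
  proof -
    have "continuous_on UNIV ((\<lambda>x. exp (- (2 * K * x)) * integral {0..x} (G v)) \<circ> cl)"
    proof (rule continuous_on_compose[OF cl_cont])
      have "continuous_on {0..L} (\<lambda>x. exp (- (2 * K * x)) * integral {0..x} (G v))"
        by (intro continuous_intros I_cont)
      then show "continuous_on (range cl) (\<lambda>x. exp (- (2 * K * x)) * integral {0..x} (G v))"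
        by (rule continuous_on_subset) (use cl in blast)
    qed
    then show ?thesis by (simp add: T_def[abs_def] o_def)
  qed
  have T_bcont: "T v \<in> bcontfun" for v
  proof -
    have "bounded ((\<lambda>x. exp (- (2 * K * x)) * integral {0..x} (G v)) ` {0..L})"
      by (intro compact_imp_bounded compact_continuous_image continuous_intros I_cont) auto
    then have "bounded (range (T v))"
      by (rule bounded_subset) (use cl in \<open>unfold T_def, blast\<close>)
    then show ?thesis using T_cont by (simp add: bcontfun_def)
  qed
  have contraction: "dist (Bcontfun (T v)) (Bcontfun (T w)) \<le> (1 / 2) * dist v w" for v w
  proof (rule dist_bound)
    fix x
    define d where "d = dist v w"
    define y where "y = cl x"
    have y: "y \<in> {0..L}" unfolding y_def by (rule cl)
    have diff: "\<bar>G v s - G w s\<bar> \<le> d * K * exp (2 * K * s)" if "s \<in> {0..y}" for s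
    proof -
      have "\<bar>G v s - G w s\<bar> \<le> K * \<bar>exp (2 * K * s) * v s - exp (2 * K * s) * w s\<bar>"
        unfolding G_def using that y by (intro lip) auto
      also have "\<dots> = K * exp (2 * K * s) * dist (v s) (w s)"
        by (simp add: dist_real_def abs_mult flip: right_diff_distrib)
      also have "\<dots> \<le> K * exp (2 * K * s) * d"
        unfolding d_def using \<open>K > 0\<close> by (intro mult_left_mono dist_bounded) auto
      finally show ?thesis by (simp add: mult_ac)
    qed
    have I: "((\<lambda>s. d * K * exp (2 * K * s)) has_integral
        d / 2 * exp (2 * K * y) - d / 2 * exp (2 * K * 0)) {0..y}"
      using y by (intro fundamental_theorem_of_calculus)
        (auto intro!: derivative_eq_intros simp flip: has_real_derivative_iff_has_vector_derivative)
    have int: "(\<lambda>s. d * K * exp (2 * K * s)) integrable_on {0..y}"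
      using I by (rule has_integral_integrable)
    have "d \<ge> 0" by (simp add: d_def)
    then have bound: "integral {0..y} (\<lambda>s. d * K * exp (2 * K * s)) \<le> d / 2 * exp (2 * K * y)"
      unfolding integral_unique[OF I] by simp
    have "\<bar>integral {0..y} (\<lambda>s. G v s - G w s)\<bar> \<le> integral {0..y} (\<lambda>s. d * K * exp (2 * K * s))"
      using integral_norm_bound_integral[of "\<lambda>s. G v s - G w s" "{0..y}" "\<lambda>s. d * K * exp (2 * K * s)"]
        G_int int diff by (auto intro: integrable_diff simp: y_def)
    with bound have "\<bar>integral {0..y} (G v) - integral {0..y} (G w)\<bar> \<le> d / 2 * exp (2 * K * y)"
      using G_int by (simp add: integral_diff y_def)
    then have "exp (- (2 * K * y)) * \<bar>integral {0..y} (G v) - integral {0..y} (G w)\<bar>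
        \<le> exp (- (2 * K * y)) * (d / 2 * exp (2 * K * y))"
      by (intro mult_left_mono) auto
    also have "\<dots> = d / 2" by (simp add: exp_minus)
    finally show "dist (apply_bcontfun (Bcontfun (T v)) x) (apply_bcontfun (Bcontfun (T w)) x)
        \<le> (1 / 2) * dist v w"
      by (simp add: Bcontfun_inverse T_bcont T_def dist_real_def abs_mult d_def y_def
          flip: right_diff_distrib)
  qed
  obtain v where v: "Bcontfun (T v) = v"
    using banach_fix_type[of "1/2" "\<lambda>v. Bcontfun (T v)"] contraction by auto
  define \<theta> where "\<theta> x = integral {0..x} (G v)" for x
  have v_eq: "exp (2 * K * x) * v x = \<theta> x" if "x \<in> {0..L}" for x
  proof -
    have "v x = T v x" by (metis Bcontfun_inverse T_bcont v)
    then show ?thesis using cl_id[OF that]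
      by (simp add: T_def \<theta>_def exp_minus field_simps)
  qed
  show ?thesis
  proof (rule that[of \<theta>])
    show "\<theta> 0 = 0" by (simp add: \<theta>_def)
    fix x assume x: "x \<in> {0..L}"
    have "(\<theta> has_real_derivative G v x) (at x within {0..L})"
      unfolding \<theta>_def using x G_cont by (intro integral_has_real_derivative)
    then show "(\<theta> has_real_derivative F x (\<theta> x)) (at x within {0..L})"
      using v_eq[OF x] by (simp add: G_def)
  qed
qed

lemma nondecreasing_within:
  fixes f :: "real \<Rightarrow> real"
  assumes "a \<le> b" "\<And>x. x \<in> {a..b} \<Longrightarrow> (f has_real_derivative f' x) (at x within {a..b})"
    "\<And>x. x \<in> {a<..<b} \<Longrightarrow> f' x \<ge> 0"
  shows "f a \<le> f b"
proof (cases "a = b")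
  case False
  then have "\<exists>x\<in>{a<..<b}. f b - f a = f' x * (b - a)"
    using assms by (intro mvt_simple) (auto simp: has_field_derivative_def)
  then show ?thesis
    using assms by (smt (verit) mult_nonneg_nonneg greaterThanLessThan_iff)
qed simp

lemma increment_le_within:
  fixes f :: "real \<Rightarrow> real"
  assumes "a \<le> b" "\<And>x. x \<in> {a..b} \<Longrightarrow> (f has_real_derivative f' x) (at x within {a..b})"
    "\<And>x. x \<in> {a<..<b} \<Longrightarrow> \<bar>f' x\<bar> \<le> c"
  shows "\<bar>f b - f a\<bar> \<le> c * (b - a)"
proof -
  have "c * a - f a \<le> c * b - f b"
    by (rule nondecreasing_within[where f = "\<lambda>x. c * x - f x" and f' = "\<lambda>x. c - f' x"])
      (use assms in \<open>force intro!: derivative_eq_intros\<close>)+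
  moreover have "c * a + f a \<le> c * b + f b"
    by (rule nondecreasing_within[where f = "\<lambda>x. c * x + f x" and f' = "\<lambda>x. c + f' x"])
      (use assms in \<open>force intro!: derivative_eq_intros\<close>)+
  ultimately show ?thesis by (simp add: algebra_simps abs_le_iff)
qed

text \<open>On an interval where \<open>D < 0\<close> the hypothesis reads \<open>D' \<ge> K D\<close>, so
  \<open>exp (- K x) D x\<close> is nondecreasing there; but it starts from a value
  \<open>\<ge> 0\<close> at the last point where \<open>D \<ge> 0\<close>. It is applied to
  differences of solutions of nonlinear equations, where \<open>K\<close> is a Lipschitz constant.\<close>

lemma differential_inequality_nonneg:
  fixes D :: "real \<Rightarrow> real"
  assumes D0: "D 0 = 0"
    and deriv: "\<And>x. x \<in> {0..L} \<Longrightarrow> (D has_real_derivative D' x) (at x within {0..L})"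
    and ineq: "\<And>x. x \<in> {0..L} \<Longrightarrow> D' x \<ge> - (K * \<bar>D x\<bar>)"
    and x: "x \<in> {0..L}"
  shows "D x \<ge> 0"
proof (rule ccontr)
  assume neg: "\<not> D x \<ge> 0"
  \<comment> \<open>\<open>Sup S\<close> is the last point before \<open>x\<close> at which \<open>D\<close> is nonnegative.\<close>
  define S where "S = {0..x} \<inter> D -` {0..}"
  have contD: "continuous_on {0..L} D"
    using deriv by (rule DERIV_continuous_on)
  have "closed S"
    unfolding S_def using x
    by (intro continuous_closed_preimage continuous_on_subset[OF contD]) auto
  moreover have "0 \<in> S" "S \<subseteq> {0..x}" using x D0 by (auto simp: S_def)
  ultimately have sup: "Sup S \<in> S" "\<And>t. t \<in> S \<Longrightarrow> t \<le> Sup S"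
    using closed_contains_Sup[of S] cSup_upper[of _ S] bdd_above_mono[of "{0..x}" S] by auto
  define a where "a = Sup S"
  have a: "0 \<le> a" "a < x" "D a \<ge> 0"
    using sup neg unfolding S_def a_def by (auto simp: order.strict_iff_order)
  have below: "D t < 0" if "t \<in> {a<..<x}" for t
  proof (rule ccontr)
    assume "\<not> D t < 0"
    then have "t \<in> S" using that a by (simp add: S_def)
    then show False using sup(2)[of t] that by (simp add: a_def)
  qed
  have "exp (- (K * a)) * D a \<le> exp (- (K * x)) * D x"
  proof (rule nondecreasing_within[where f = "\<lambda>x. exp (- (K * x)) * D x" and a = a and b = x
        and f' = "\<lambda>t. exp (- (K * t)) * (D' t - K * D t)"])
    fix t assume t: "t \<in> {a..x}"
    show "((\<lambda>x. exp (- (K * x)) * D x) has_real_derivative exp (- (K * t)) * (D' t - K * D t))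
        (at t within {a..x})"
      using t a x by (auto intro!: derivative_eq_intros DERIV_subset[OF deriv] simp: algebra_simps)
  next
    fix t assume t: "t \<in> {a<..<x}"
    then have "D' t \<ge> K * D t" using ineq[of t] below[OF t] a x by auto
    then show "exp (- (K * t)) * (D' t - K * D t) \<ge> 0" by simp
  qed (use a in auto)
  moreover have "exp (- (K * a)) * D a \<ge> 0" using a by simp
  moreover have "exp (- (K * x)) * D x < 0" using neg by (simp add: mult_pos_neg)
  ultimately show False by linarith
qed

text \<open>At a first arrival at \<open>c\<close> from below the derivative could not be negative. The start
  \<open>f 0 = c\<close> is allowed, since then \<open>f\<close> drops below \<open>c\<close> at
  once; this case is what shows that a Prufer angle starting at \<open>0\<close> is positive
  afterwards.\<close>

lemma barrier_not_reached:
  fixes f :: "real \<Rightarrow> real"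
  assumes "L > 0" and start: "f 0 \<le> c"
    and deriv: "\<And>x. x \<in> {0..L} \<Longrightarrow> (f has_real_derivative f' x) (at x within {0..L})"
    and barrier: "\<And>x. x \<in> {0..L} \<Longrightarrow> f x = c \<Longrightarrow> f' x < 0"
    and x: "x \<in> {0<..L}"
  shows "f x < c"
proof (rule ccontr)
  assume nless: "\<not> f x < c"
  have contf: "continuous_on {0..L} f"
    using deriv by (rule DERIV_continuous_on)
  have "\<exists>d>0. \<forall>t. 0 < t \<and> t < d \<and> t \<le> L \<longrightarrow> f t < c"
  proof (cases "f 0 = c")
    case True
    then obtain d where "d > 0" "\<And>h. 0 < h \<Longrightarrow> 0 + h \<in> {0..L} \<Longrightarrow> h < d \<Longrightarrow> f (0 + h) < f 0"
      using has_real_derivative_neg_dec_right[OF deriv[of 0] barrier[of 0]] \<open>L > 0\<close> by auto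
    then show ?thesis using True by auto
  next
    case False
    then have "f 0 < c" using start by simp
    then have "\<forall>\<^sub>F t in at 0 within {0..L}. f t < c"
      using contf \<open>L > 0\<close> by (intro order_tendstoD(2)[of f "f 0"]) (auto simp: continuous_on_def)
    then show ?thesis unfolding eventually_at by (auto simp: dist_real_def)
  qed
  then obtain d where d: "d > 0" "\<And>t. 0 < t \<Longrightarrow> t < d \<Longrightarrow> t \<le> L \<Longrightarrow> f t < c" by auto
  \<comment> \<open>\<open>Inf S\<close> is the first point, away from \<open>0\<close>, at which \<open>c\<close> is reached.\<close>
  define S where "S = {min x (d / 2)..x} \<inter> f -` {c..}"
  have "closed S"
    unfolding S_def using x d
    by (intro continuous_closed_preimage continuous_on_subset[OF contf]) auto
  moreover have "x \<in> S" "S \<subseteq> {min x (d / 2)..x}" using x nless by (auto simp: S_def)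
  ultimately have inf: "Inf S \<in> S" "\<And>t. t \<in> S \<Longrightarrow> Inf S \<le> t"
    using closed_contains_Inf[of S] cInf_lower[of _ S] bdd_below_mono[of "{min x (d / 2)..x}" S]
    by auto
  define a where "a = Inf S"
  have a: "0 < a" "a \<le> x" "f a \<ge> c"
    using inf(1) x d unfolding S_def a_def by (auto simp: min_def split: if_splits)
  have below: "f t < c" if "0 < t" "t < a" for t
  proof (rule ccontr)
    assume nless: "\<not> f t < c"
    have "t \<le> L" using that a x by simp
    then have "t \<ge> d" using d(2)[of t] that(1) nless by (meson not_le)
    then have "t \<in> S" using nless that a \<open>d > 0\<close> by (simp add: S_def)
    then show False using inf(2)[of t] that by (simp add: a_def)
  qed
  have "f a \<le> c"
  proof (rule ccontr)
    assume "\<not> f a \<le> c"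
    moreover have "(f \<longlongrightarrow> f a) (at a within {0..L})"
      using contf a x by (auto simp: continuous_on_def)
    ultimately have "\<forall>\<^sub>F t in at a within {0..L}. f t > c"
      by (intro order_tendstoD(1)[of f "f a"]) auto
    then obtain e where e: "e > 0" "\<And>t. t \<in> {0..L} \<Longrightarrow> t \<noteq> a \<Longrightarrow> \<bar>t - a\<bar> < e \<Longrightarrow> f t > c"
      unfolding eventually_at by (auto simp: dist_real_def)
    have "f (max (a / 2) (a - e / 2)) > c" using a x e(1) by (intro e(2)) auto
    moreover have "f (max (a / 2) (a - e / 2)) < c" using a e(1) by (intro below) auto
    ultimately show False by simp
  qed
  with a have "f a = c" by simp
  then obtain e where e: "e > 0" "\<And>h. 0 < h \<Longrightarrow> a - h \<in> {0..L} \<Longrightarrow> h < e \<Longrightarrow> f (a - h) > f a"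
    using has_real_derivative_neg_dec_left[OF deriv[of a] barrier[of a]] a x by auto
  have "f (a - min (a / 2) (e / 2)) > f a" using a x e(1) by (intro e(2)) auto
  moreover have "f (a - min (a / 2) (e / 2)) < c" using a e(1) by (intro below) auto
  ultimately show False using \<open>f a = c\<close> by simp
qed

section \<open>Absolutely continuous functions with a continuous derivative\<close>

lemma absolutely_continuous_on_subinterval:
  assumes "absolutely_continuous_on a b f" "a \<le> c" "d \<le> b"
  shows "absolutely_continuous_on c d f"
  unfolding absolutely_continuous_on_def
proof (intro allI impI)
  fix e :: real assume "e > 0"
  then obtain \<delta> where "\<delta> > 0" and \<delta>: "\<And>I. finite I \<Longrightarrow> (\<forall>(u, v)\<in>I. a \<le> u \<and> u \<le> v \<and> v \<le> b) \<Longrightarrow>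
      disjoint_family_on (\<lambda>(u, v). {u<..<v}) I \<Longrightarrow> (\<Sum>(u, v)\<in>I. v - u) < \<delta> \<Longrightarrow>
      (\<Sum>(u, v)\<in>I. norm (f v - f u)) < e"
    using assms(1) unfolding absolutely_continuous_on_def by meson
  have "(\<Sum>(u, v)\<in>I. norm (f v - f u)) < e"
    if "finite I \<and> (\<forall>(u, v)\<in>I. c \<le> u \<and> u \<le> v \<and> v \<le> d) \<and>
      disjoint_family_on (\<lambda>(u, v). {u<..<v}) I \<and> (\<Sum>(u, v)\<in>I. v - u) < \<delta>" for I
  proof (rule \<delta>)
    show "\<forall>(u, v)\<in>I. a \<le> u \<and> u \<le> v \<and> v \<le> b" using that assms(2,3) by fastforce
  qed (use that in auto)
  then show "\<exists>\<delta>>0. \<forall>I. finite I \<and> (\<forall>(u, v)\<in>I. c \<le> u \<and> u \<le> v \<and> v \<le> d) \<and>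
      disjoint_family_on (\<lambda>(u, v). {u<..<v}) I \<and> (\<Sum>(u, v)\<in>I. v - u) < \<delta> \<longrightarrow>
      (\<Sum>(u, v)\<in>I. norm (f v - f u)) < e"
    using \<open>\<delta> > 0\<close> by blast
qed

lemma absolutely_continuous_on_diff:
  assumes "absolutely_continuous_on a b f" "absolutely_continuous_on a b g"
  shows "absolutely_continuous_on a b (\<lambda>x. f x - g x)"
  unfolding absolutely_continuous_on_def
proof (intro allI impI)
  fix e :: real assume "e > 0"
  then have "e / 2 > 0" by simp
  obtain \<delta>1 where "\<delta>1 > 0" and \<delta>1: "\<And>I. finite I \<Longrightarrow> (\<forall>(u, v)\<in>I. a \<le> u \<and> u \<le> v \<and> v \<le> b) \<Longrightarrow>
      disjoint_family_on (\<lambda>(u, v). {u<..<v}) I \<Longrightarrow> (\<Sum>(u, v)\<in>I. v - u) < \<delta>1 \<Longrightarrow>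
      (\<Sum>(u, v)\<in>I. norm (f v - f u)) < e / 2"
    using assms(1) \<open>e / 2 > 0\<close> unfolding absolutely_continuous_on_def by meson
  obtain \<delta>2 where "\<delta>2 > 0" and \<delta>2: "\<And>I. finite I \<Longrightarrow> (\<forall>(u, v)\<in>I. a \<le> u \<and> u \<le> v \<and> v \<le> b) \<Longrightarrow>
      disjoint_family_on (\<lambda>(u, v). {u<..<v}) I \<Longrightarrow> (\<Sum>(u, v)\<in>I. v - u) < \<delta>2 \<Longrightarrow>
      (\<Sum>(u, v)\<in>I. norm (g v - g u)) < e / 2"
    using assms(2) \<open>e / 2 > 0\<close> unfolding absolutely_continuous_on_def by meson
  have "(\<Sum>(u, v)\<in>I. norm ((f v - g v) - (f u - g u))) < e"
    if "finite I \<and> (\<forall>(u, v)\<in>I. a \<le> u \<and> u \<le> v \<and> v \<le> b) \<and>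
      disjoint_family_on (\<lambda>(u, v). {u<..<v}) I \<and> (\<Sum>(u, v)\<in>I. v - u) < min \<delta>1 \<delta>2" for I
  proof -
    have "(\<Sum>(u, v)\<in>I. norm ((f v - g v) - (f u - g u)))
        \<le> (\<Sum>(u, v)\<in>I. norm (f v - f u) + norm (g v - g u))"
    proof (rule sum_mono, clarify)
      fix u v
      show "norm ((f v - g v) - (f u - g u)) \<le> norm (f v - f u) + norm (g v - g u)"
        using norm_triangle_ineq4[of "f v - f u" "g v - g u"] by (simp add: algebra_simps)
    qed
    also have "\<dots> = (\<Sum>(u, v)\<in>I. norm (f v - f u)) + (\<Sum>(u, v)\<in>I. norm (g v - g u))"
      by (simp add: case_prod_unfold sum.distrib)
    also have "\<dots> < e / 2 + e / 2"
      using that by (intro add_strict_mono \<delta>1 \<delta>2) auto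
    finally show ?thesis by simp
  qed
  then show "\<exists>\<delta>>0. \<forall>I. finite I \<and> (\<forall>(u, v)\<in>I. a \<le> u \<and> u \<le> v \<and> v \<le> b) \<and>
      disjoint_family_on (\<lambda>(u, v). {u<..<v}) I \<and> (\<Sum>(u, v)\<in>I. v - u) < \<delta> \<longrightarrow>
      (\<Sum>(u, v)\<in>I. norm ((f v - g v) - (f u - g u))) < e"
    using \<open>\<delta>1 > 0\<close> \<open>\<delta>2 > 0\<close> by (intro exI[of _ "min \<delta>1 \<delta>2"]) simp
qed

lemma lipschitz_imp_absolutely_continuous_on:
  assumes "\<And>u v. a \<le> u \<Longrightarrow> u \<le> v \<Longrightarrow> v \<le> b \<Longrightarrow> norm (f v - f u) \<le> K * (v - u)"
  shows "absolutely_continuous_on a b f"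
  unfolding absolutely_continuous_on_def
proof (intro allI impI)
  fix e :: real assume "e > 0"
  define C where "C = \<bar>K\<bar> + 1"
  have "C > 0" by (simp add: C_def)
  have "(\<Sum>(u, v)\<in>I. norm (f v - f u)) < e"
    if I: "finite I \<and> (\<forall>(u, v)\<in>I. a \<le> u \<and> u \<le> v \<and> v \<le> b) \<and>
      disjoint_family_on (\<lambda>(u, v). {u<..<v}) I \<and> (\<Sum>(u, v)\<in>I. v - u) < e / C" for I
  proof -
    have "(\<Sum>(u, v)\<in>I. norm (f v - f u)) \<le> (\<Sum>(u, v)\<in>I. C * (v - u))"
    proof (rule sum_mono, clarify)
      fix u v assume uv: "(u, v) \<in> I"
      then have "a \<le> u" "u \<le> v" "v \<le> b" using I by auto
      then have "norm (f v - f u) \<le> K * (v - u)" by (rule assms)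
      also have "\<dots> \<le> C * (v - u)"
        using \<open>u \<le> v\<close> by (intro mult_right_mono) (auto simp: C_def)
      finally show "norm (f v - f u) \<le> C * (v - u)" .
    qed
    also have "\<dots> = C * (\<Sum>(u, v)\<in>I. v - u)"
      by (simp add: case_prod_unfold sum_distrib_left)
    also have "\<dots> < C * (e / C)"
      using I \<open>C > 0\<close> by (intro mult_strict_left_mono) auto
    finally show ?thesis using \<open>C > 0\<close> by simp
  qed
  then show "\<exists>\<delta>>0. \<forall>I. finite I \<and> (\<forall>(u, v)\<in>I. a \<le> u \<and> u \<le> v \<and> v \<le> b) \<and>
      disjoint_family_on (\<lambda>(u, v). {u<..<v}) I \<and> (\<Sum>(u, v)\<in>I. v - u) < \<delta> \<longrightarrow>
      (\<Sum>(u, v)\<in>I. norm (f v - f u)) < e"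
    using \<open>e > 0\<close> \<open>C > 0\<close> by (intro exI[of _ "e / C"]) simp
qed

lemma absolutely_continuous_on_imp_continuous_on:
  assumes "absolutely_continuous_on a b f"
  shows "continuous_on {a..b} f"
  unfolding continuous_on_iff
proof (intro ballI allI impI)
  fix x e :: real assume x: "x \<in> {a..b}" and "e > 0"
  then obtain \<delta> where "\<delta> > 0" and \<delta>: "\<And>I. finite I \<Longrightarrow> (\<forall>(u, v)\<in>I. a \<le> u \<and> u \<le> v \<and> v \<le> b) \<Longrightarrow>
      disjoint_family_on (\<lambda>(u, v). {u<..<v}) I \<Longrightarrow> (\<Sum>(u, v)\<in>I. v - u) < \<delta> \<Longrightarrow>
      (\<Sum>(u, v)\<in>I. norm (f v - f u)) < e"
    using assms unfolding absolutely_continuous_on_def by meson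
  have "dist (f y) (f x) < e" if "y \<in> {a..b}" "dist y x < \<delta>" for y
  proof (cases "x \<le> y")
    case True
    then show ?thesis using \<delta>[of "{(x, y)}"] x that by (simp add: disjoint_family_on_def dist_norm)
  next
    case False
    then show ?thesis using \<delta>[of "{(y, x)}"] x that
      by (simp add: disjoint_family_on_def dist_norm norm_minus_commute)
  qed
  then show "\<exists>d>0. \<forall>y\<in>{a..b}. dist y x < d \<longrightarrow> dist (f y) (f x) < e"
    using \<open>\<delta> > 0\<close> by blast
qed

text \<open>Cover the exceptional null set \<open>N\<close> by an open set \<open>U\<close> of measure less than
  the \<open>\<delta>\<close> of absolute continuity, and take a tagged division of
  \<open>[a,b]\<close> so fine that intervals with tag in \<open>N\<close> lie inside
  \<open>U\<close>, while on the others \<open>f\<close> changes by at most \<open>e\<close> times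
  the length. Absolute continuity bounds the total change over the first kind, the zero derivative
  over the second.\<close>

lemma absolutely_continuous_zero_derivative:
  fixes f :: "real \<Rightarrow> complex"
  assumes "a \<le> b" and ac: "absolutely_continuous_on a b f" and N: "negligible N"
    and deriv: "\<And>x. x \<in> {a..b} - N \<Longrightarrow> (f has_vector_derivative 0) (at x within {a..b})"
  shows "f b = f a"
proof -
  have "norm (f b - f a) \<le> e * (1 + (b - a))" if "e > 0" for e
  proof -
    obtain \<delta> where "\<delta> > 0" and \<delta>: "\<And>I. finite I \<Longrightarrow> (\<forall>(u, v)\<in>I. a \<le> u \<and> u \<le> v \<and> v \<le> b) \<Longrightarrow>
      disjoint_family_on (\<lambda>(u, v). {u<..<v}) I \<Longrightarrow> (\<Sum>(u, v)\<in>I. v - u) < \<delta> \<Longrightarrow>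
      (\<Sum>(u, v)\<in>I. norm (f v - f u)) < e"
      using ac \<open>e > 0\<close> unfolding absolutely_continuous_on_def by meson
    have N0: "N \<in> null_sets lebesgue" using N by (simp add: negligible_iff_null_sets)
    obtain U where U: "open U" "N \<subseteq> U" "U - N \<in> lmeasurable" "emeasure lebesgue (U - N) < ennreal \<delta>"
      using sets_lebesgue_outer_open[of N \<delta>] N0 \<open>\<delta> > 0\<close> by (auto simp: null_sets_def)
    have U_sets: "U \<in> sets lebesgue" using U(1) by simp
    have U_less: "emeasure lebesgue U < ennreal \<delta>"
      using U(4) emeasure_Diff_null_set[OF N0 U_sets] by simp
    have "\<exists>d>0. \<forall>y\<in>{a..b}. \<bar>y - x\<bar> < d \<longrightarrow> norm (f y - f x) \<le> e * \<bar>y - x\<bar>"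
      if "x \<in> {a..b} - N" for x
      using deriv[OF that] \<open>e > 0\<close>
      unfolding has_vector_derivative_def has_derivative_within_alt by auto
    then obtain r where r: "\<And>x. x \<in> {a..b} - N \<Longrightarrow> r x > 0"
      "\<And>x y. x \<in> {a..b} - N \<Longrightarrow> y \<in> {a..b} \<Longrightarrow> \<bar>y - x\<bar> < r x \<Longrightarrow> norm (f y - f x) \<le> e * \<bar>y - x\<bar>"
      by metis
    define \<gamma> where "\<gamma> x = (if x \<in> N then U else if x \<in> {a..b} then ball x (r x) else ball x 1)" for x
    have "gauge \<gamma>"
      using U r(1) by (auto simp: gauge_def \<gamma>_def)
    then obtain p where p: "p tagged_division_of {a..b}" "\<gamma> fine p"
      using fine_division_exists_real by blast
    note pD = tagged_division_ofD[OF p(1)]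
    have K: "K = {Inf K..Sup K}" "a \<le> Inf K" "Inf K \<le> x" "x \<le> Sup K" "Sup K \<le> b" "K \<subseteq> \<gamma> x"
      if xK: "(x, K) \<in> p" for x K
    proof -
      obtain u v where uv: "K = {u..v}" using pD(4)[OF xK] by auto
      have "x \<in> K" using pD(2)[OF xK] .
      then have "u \<le> x" "x \<le> v" "u \<le> v" using uv by auto
      then have IS: "Inf K = u" "Sup K = v" using uv by auto
      show "K = {Inf K..Sup K}" "Inf K \<le> x" "x \<le> Sup K" using uv IS \<open>u \<le> x\<close> \<open>x \<le> v\<close> by auto
      show "a \<le> Inf K" "Sup K \<le> b" using pD(3)[OF xK] uv IS \<open>u \<le> v\<close> by auto
      show "K \<subseteq> \<gamma> x" using p(2) xK by (auto simp: fine_def)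
    qed
    define G where "G = {t \<in> p. fst t \<notin> N}"
    define B where "B = {t \<in> p. fst t \<in> N}"
    have fin: "finite G" "finite B" using pD(1) by (auto simp: G_def B_def)
    have good: "norm (\<Sum>(x, K)\<in>G. f (Sup K) - f (Inf K)) \<le> e * (b - a)"
    proof -
      have "norm (\<Sum>(x, K)\<in>G. f (Sup K) - f (Inf K)) \<le> (\<Sum>(x, K)\<in>G. e * (Sup K - Inf K))"
        unfolding case_prod_unfold
      proof (rule sum_norm_le)
        fix t assume t: "t \<in> G"
        obtain x K where xK: "t = (x, K)" by (cases t)
        have m: "(x, K) \<in> p" "x \<notin> N" using t xK by (auto simp: G_def)
        note k = K[OF m(1)]
        have x: "x \<in> {a..b} - N" using k m by auto
        have "Inf K \<in> K" "Sup K \<in> K" using k(1,3,4) by (metis atLeastAtMost_iff order_refl order_trans)+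
        then have near: "\<bar>Inf K - x\<bar> < r x" "\<bar>Sup K - x\<bar> < r x"
          using k(6) x by (auto simp: \<gamma>_def dist_real_def abs_minus_commute)
        have "norm (f (Sup K) - f (Inf K)) \<le> norm (f (Sup K) - f x) + norm (f (Inf K) - f x)"
          using norm_triangle_ineq4[of "f (Sup K) - f x" "f (Inf K) - f x"] by simp
        also have "\<dots> \<le> e * \<bar>Sup K - x\<bar> + e * \<bar>Inf K - x\<bar>"
          using k near x by (intro add_mono r(2)) auto
        also have "\<dots> = e * (Sup K - Inf K)" using k by (simp add: algebra_simps)
        finally show "norm (f (Sup (snd t)) - f (Inf (snd t))) \<le> e * (Sup (snd t) - Inf (snd t))"
          by (simp add: xK)
      qed
      also have "\<dots> \<le> (\<Sum>(x, K)\<in>p. e * (Sup K - Inf K))"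
        using K(3,4) \<open>e > 0\<close> pD(1) by (intro sum_mono2) (fastforce simp: G_def)+
      also have "\<dots> = e * (\<Sum>(x, K)\<in>p. Sup K - Inf K)"
        by (simp add: case_prod_unfold sum_distrib_left)
      also have "(\<Sum>(x, K)\<in>p. Sup K - Inf K) = b - a"
        using additive_tagged_division_1[OF \<open>a \<le> b\<close> p(1), of "\<lambda>x. x"] by simp
      finally show ?thesis .
    qed
    have bad: "norm (\<Sum>(x, K)\<in>B. f (Sup K) - f (Inf K)) \<le> e"
    proof -
      \<comment> \<open>Degenerate intervals must go: two of them may share their endpoints, and \<open>ends\<close> would not be injective.\<close>
      define B' where "B' = {t \<in> B. Inf (snd t) < Sup (snd t)}"
      define ends where "ends t = (Inf (snd t), Sup (snd t))" for t :: "real \<times> real set"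
      have B': "(x, K) \<in> p" "x \<in> N" "Inf K < Sup K" if "(x, K) \<in> B'" for x K
        using that by (auto simp: B'_def B_def)
      have disj: "{Inf K<..<Sup K} \<inter> {Inf K'<..<Sup K'} = {}"
        if "(x, K) \<in> B'" "(x', K') \<in> B'" "(x, K) \<noteq> (x', K')" for x K x' K'
        using pD(5)[OF B'(1)[OF that(1)] B'(1)[OF that(2)] that(3)]
          K(1)[OF B'(1)[OF that(1)]] K(1)[OF B'(1)[OF that(2)]]
        by (metis interior_atLeastAtMost_real)
      have inj: "inj_on ends B'"
      proof (rule inj_onI)
        fix s t assume st: "s \<in> B'" "t \<in> B'" "ends s = ends t"
        show "s = t"
        proof (rule ccontr)
          assume "s \<noteq> t"
          then have "{Inf (snd s)<..<Sup (snd s)} \<inter> {Inf (snd t)<..<Sup (snd t)} = {}"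
            using disj[of "fst s" "snd s" "fst t" "snd t"] st by simp
          then have "{Inf (snd s)<..<Sup (snd s)} = {}" using st(3) by (simp add: ends_def)
          then show False using st(1) by (simp add: B'_def)
        qed
      qed
      have disjI: "disjoint_family_on (\<lambda>(u, v). {u<..<v}) (ends ` B')"
        using disj inj unfolding disjoint_family_on_def ends_def by fastforce
      have finB': "finite (ends ` B')" using fin by (simp add: B'_def)
      have "ennreal (\<Sum>(u, v)\<in>ends ` B'. v - u) = (\<Sum>t\<in>ends ` B'. emeasure lebesgue {fst t<..<snd t})"
        by (subst sum_ennreal[symmetric]) (auto simp: case_prod_unfold ends_def B'_def intro!: sum.cong)
      also have "\<dots> = emeasure lebesgue (\<Union>t\<in>ends ` B'. {fst t<..<snd t})"
        using disjI finB' by (intro sum_emeasure) (auto simp: case_prod_unfold)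
      also have "\<dots> \<le> emeasure lebesgue U"
      proof (rule emeasure_mono)
        show "(\<Union>t\<in>ends ` B'. {fst t<..<snd t}) \<subseteq> U"
        proof
          fix z assume "z \<in> (\<Union>t\<in>ends ` B'. {fst t<..<snd t})"
          then obtain x K' where xK: "(x, K') \<in> B'" "z \<in> {Inf K'<..<Sup K'}" by (auto simp: ends_def)
          then have "z \<in> K'" using K(1)[OF B'(1)[OF xK(1)]] by (metis atLeastAtMost_iff greaterThanLessThan_iff less_imp_le)
          then show "z \<in> U" using K(6)[OF B'(1)[OF xK(1)]] B'(2)[OF xK(1)] by (auto simp: \<gamma>_def)
        qed
      qed (use U_sets in simp)
      also have "\<dots> < ennreal \<delta>" by (rule U_less)
      finally have short: "(\<Sum>(u, v)\<in>ends ` B'. v - u) < \<delta>"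
        by (metis ennreal_leI not_less)
      have "norm (\<Sum>(x, K)\<in>B. f (Sup K) - f (Inf K)) = norm (\<Sum>(x, K)\<in>B'. f (Sup K) - f (Inf K))"
      proof (rule arg_cong[of _ _ norm], rule sum.mono_neutral_right[OF fin(2)])
        show "\<forall>t\<in>B - B'. (case t of (x, K) \<Rightarrow> f (Sup K) - f (Inf K)) = 0"
        proof
          fix t assume t: "t \<in> B - B'"
          obtain x K' where xK: "t = (x, K')" by (cases t)
          have "Inf K' \<le> Sup K'" using K(3,4)[of x K'] t xK by (force simp: B_def)
          moreover have "\<not> Inf K' < Sup K'" using t xK by (auto simp: B'_def)
          ultimately have "Sup K' = Inf K'" by simp
          then show "(case t of (x, K) \<Rightarrow> f (Sup K) - f (Inf K)) = 0" by (simp add: xK)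
        qed
      qed (auto simp: B'_def)
      also have "\<dots> \<le> (\<Sum>t\<in>B'. norm (f (Sup (snd t)) - f (Inf (snd t))))"
        unfolding case_prod_unfold by (rule norm_sum)
      also have "\<dots> = (\<Sum>(u, v)\<in>ends ` B'. norm (f v - f u))"
        by (subst sum.reindex[OF inj]) (simp add: ends_def o_def)
      also have "\<dots> < e"
      proof (rule \<delta>[OF finB' _ disjI short])
        show "\<forall>(u, v)\<in>ends ` B'. a \<le> u \<and> u \<le> v \<and> v \<le> b"
        proof clarify
          fix u v x K' assume "(u, v) = ends (x, K')" "(x, K') \<in> B'"
          then show "a \<le> u \<and> u \<le> v \<and> v \<le> b"
            using K(2,5)[OF B'(1)] less_imp_le[OF B'(3)] by (auto simp: ends_def)
        qed
      qed
      finally show ?thesis by simp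
    qed
    have "f b - f a = (\<Sum>(x, K)\<in>p. f (Sup K) - f (Inf K))"
      using additive_tagged_division_1[OF \<open>a \<le> b\<close> p(1), of f] by simp
    also have "\<dots> = (\<Sum>(x, K)\<in>G \<union> B. f (Sup K) - f (Inf K))"
      by (rule sum.cong) (auto simp: G_def B_def)
    also have "\<dots> = (\<Sum>(x, K)\<in>G. f (Sup K) - f (Inf K)) + (\<Sum>(x, K)\<in>B. f (Sup K) - f (Inf K))"
      using fin by (intro sum.union_disjoint) (auto simp: G_def B_def)
    finally have "norm (f b - f a) \<le> e * (b - a) + e"
      using good bad norm_triangle_ineq[of "\<Sum>(x, K)\<in>G. f (Sup K) - f (Inf K)"
          "\<Sum>(x, K)\<in>B. f (Sup K) - f (Inf K)"] by (simp only:)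
    then show ?thesis by (simp add: algebra_simps)
  qed
  note le = this
  have "norm (f b - f a) \<le> 0"
  proof (rule field_le_epsilon)
    fix e :: real assume "e > 0"
    then show "norm (f b - f a) \<le> 0 + e"
      using le[of "e / (1 + (b - a))"] \<open>a \<le> b\<close> by (simp add: divide_simps)
  qed
  then show ?thesis by simp
qed

text \<open>The passage from the almost-everywhere equations in the definition of the operator to classical
  differential equations: when the almost-everywhere derivative has a continuous representative,
  \<open>f\<close> differs from the primitive of that representative by an absolutely continuous
  function with zero derivative.\<close>

lemma absolutely_continuous_on_has_derivative:
  fixes f g :: "real \<Rightarrow> complex"
  assumes "L > 0" and ac: "absolutely_continuous_on 0 L f" and g: "continuous_on {0..L} g"
    and ae: "AE x in lebesgue_on {0<..<L}. (f has_vector_derivative g x) (at x)"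
    and x: "x \<in> {0..L}"
  shows "(f has_vector_derivative g x) (at x within {0..L})"
proof -
  define G where "G z = integral {0..z} g" for z
  have G': "(G has_vector_derivative g z) (at z within {0..L})" if "z \<in> {0..L}" for z
    unfolding G_def using g that by (rule integral_has_vector_derivative)
  have "bounded (g ` {0..L})"
    by (intro compact_imp_bounded compact_continuous_image g) auto
  then obtain K where "\<forall>z\<in>g ` {0..L}. norm z \<le> K" unfolding bounded_iff by blast
  then have K: "\<And>z. z \<in> {0..L} \<Longrightarrow> norm (g z) \<le> K" by blast
  have "absolutely_continuous_on 0 L G"
  proof (rule lipschitz_imp_absolutely_continuous_on)
    fix u v :: real assume uv: "0 \<le> u" "u \<le> v" "v \<le> L"
    have gi: "continuous_on {a..b} g" if "0 \<le> a" "b \<le> L" for a b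
      using that by (intro continuous_on_subset[OF g]) auto
    have "G u + integral {u..v} g = G v"
      unfolding G_def using uv
      by (intro Henstock_Kurzweil_Integration.integral_combine integrable_continuous_real gi) auto
    then have "G v - G u = integral {u..v} g" by (simp add: algebra_simps)
    then show "norm (G v - G u) \<le> K * (v - u)"
      using uv by (simp only:) (intro integral_bound gi K, auto)
  qed
  then have ac_diff: "absolutely_continuous_on 0 L (\<lambda>z. f z - G z)"
    by (intro absolutely_continuous_on_diff ac)
  obtain N where N: "N \<in> null_sets lebesgue"
    and fN: "\<And>z. z \<in> {0<..<L} \<Longrightarrow> z \<notin> N \<Longrightarrow> (f has_vector_derivative g z) (at z)"
  proof -
    have "AE z in lebesgue. z \<in> {0<..<L} \<longrightarrow> (f has_vector_derivative g z) (at z)"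
      using ae by (subst (asm) AE_restrict_space_iff) auto
    then obtain N where "N \<in> null_sets lebesgue"
      "{z \<in> space lebesgue. \<not> (z \<in> {0<..<L} \<longrightarrow> (f has_vector_derivative g z) (at z))} \<subseteq> N"
      unfolding eventually_ae_filter by blast
    then show ?thesis using that[of N] by auto
  qed
  have f_eq: "f z = f 0 + G z" if z: "z \<in> {0..L}" for z
  proof -
    have "f z - G z = f 0 - G 0"
    proof (rule absolutely_continuous_zero_derivative[where N = "N \<union> {0, L}"])
      show "absolutely_continuous_on 0 z (\<lambda>z. f z - G z)"
        using z by (intro absolutely_continuous_on_subinterval[OF ac_diff]) auto
      show "negligible (N \<union> {0, L})" using N by (simp add: negligible_iff_null_sets negligible_Un)
      fix t assume t: "t \<in> {0..z} - (N \<union> {0, L})"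
      have f: "(f has_vector_derivative g t) (at t within {0..z})"
        using t z by (intro has_vector_derivative_at_within[OF fN]) auto
      have "(G has_vector_derivative g t) (at t within {0..z})"
        using t z by (intro has_vector_derivative_within_subset[OF G']) auto
      from has_vector_derivative_diff[OF f this]
      show "((\<lambda>z. f z - G z) has_vector_derivative 0) (at t within {0..z})" by simp
    qed (use z in auto)
    then show ?thesis by (simp add: G_def algebra_simps)
  qed
  have "((\<lambda>z. f 0 + G z) has_vector_derivative g x) (at x within {0..L})"
    using G'[OF x] by (auto intro!: derivative_eq_intros)
  then show ?thesis
    by (rule has_vector_derivative_transform_within[where d = 1]) (simp_all only: x f_eq[symmetric] zero_less_one)
qed

section \<open>The Prufer angle and its dependence on the energy\<close>

text \<open>The derivative of the polar angle \<open>t\<close> of \<open>(u, y) = r (cos t, sin t)\<close> along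
  the eigenvalue equation \<open>y' = u + \<sigma> y\<close>,
  \<open>u' = - \<sigma> u - (\<sigma>\<^sup>2 + \<mu>) y\<close>.\<close>

definition prufer_rhs :: "(real \<Rightarrow> real) \<Rightarrow> real \<Rightarrow> real \<Rightarrow> real \<Rightarrow> real" where
  "prufer_rhs \<sigma> \<mu> x t = (cos t + \<sigma> x * sin t)\<^sup>2 + \<mu> * (sin t)\<^sup>2"

definition prufer_angle :: "real \<Rightarrow> (real \<Rightarrow> real) \<Rightarrow> real \<Rightarrow> (real \<Rightarrow> real) \<Rightarrow> bool" where
  "prufer_angle L \<sigma> \<mu> \<theta> \<longleftrightarrow> \<theta> 0 = 0 \<and>
     (\<forall>x\<in>{0..L}. (\<theta> has_real_derivative prufer_rhs \<sigma> \<mu> x (\<theta> x)) (at x within {0..L}))"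

lemma prufer_angleD:
  assumes "prufer_angle L \<sigma> \<mu> \<theta>"
  shows "\<theta> 0 = 0" "\<And>x. x \<in> {0..L} \<Longrightarrow>
    (\<theta> has_real_derivative prufer_rhs \<sigma> \<mu> x (\<theta> x)) (at x within {0..L})"
    "continuous_on {0..L} \<theta>"
  using assms unfolding prufer_angle_def by (auto intro: DERIV_continuous_on)

lemma prufer_rhs_double_angle:
  "prufer_rhs \<sigma> \<mu> x t =
     (1 + (\<sigma> x)\<^sup>2 + \<mu>) / 2 + (1 - (\<sigma> x)\<^sup>2 - \<mu>) / 2 * cos (2 * t) + \<sigma> x * sin (2 * t)"
  unfolding prufer_rhs_def cos_double_sin sin_double power2_sum power_mult_distrib cos_squared_eq
  by (simp add: field_simps)

text \<open>In the double-angle form the only nonlinearities are \<open>cos (2 t)\<close> and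
  \<open>sin (2 t)\<close>, so the Lipschitz constant is global in \<open>t\<close>.\<close>

lemma prufer_rhs_lipschitz:
  assumes "\<bar>\<sigma> x\<bar> \<le> M"
  shows "\<bar>prufer_rhs \<sigma> \<mu> x s - prufer_rhs \<sigma> \<mu> x t\<bar> \<le> (1 + 2 * M + M\<^sup>2 + \<bar>\<mu>\<bar>) * \<bar>s - t\<bar>"
proof -
  have sq: "(\<sigma> x)\<^sup>2 \<le> M\<^sup>2" using assms by (simp add: abs_le_square_iff[symmetric])
  have half: "\<bar>sin ((2 * u - 2 * v) / 2)\<bar> \<le> \<bar>u - v\<bar>" for u v :: real
    using abs_sin_x_le_abs_x[of "u - v"] by (simp add: diff_divide_distrib)
  have cos: "\<bar>cos (2 * s) - cos (2 * t)\<bar> \<le> 2 * \<bar>s - t\<bar>"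
  proof -
    have "\<bar>cos (2 * s) - cos (2 * t)\<bar>
        = 2 * \<bar>sin ((2 * s + 2 * t) / 2)\<bar> * \<bar>sin ((2 * t - 2 * s) / 2)\<bar>"
      by (simp add: cos_diff_cos abs_mult)
    also have "\<dots> \<le> 2 * 1 * \<bar>t - s\<bar>"
      by (intro mult_mono half) auto
    finally show ?thesis by (simp add: abs_minus_commute)
  qed
  have sin: "\<bar>sin (2 * s) - sin (2 * t)\<bar> \<le> 2 * \<bar>s - t\<bar>"
  proof -
    have "\<bar>sin (2 * s) - sin (2 * t)\<bar>
        = 2 * \<bar>sin ((2 * s - 2 * t) / 2)\<bar> * \<bar>cos ((2 * s + 2 * t) / 2)\<bar>"
      by (simp add: sin_diff_sin abs_mult)
    also have "\<dots> \<le> 2 * \<bar>s - t\<bar> * 1"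
      by (intro mult_mono half) auto
    finally show ?thesis by simp
  qed
  have "\<bar>prufer_rhs \<sigma> \<mu> x s - prufer_rhs \<sigma> \<mu> x t\<bar>
      = \<bar>(1 - (\<sigma> x)\<^sup>2 - \<mu>) / 2 * (cos (2 * s) - cos (2 * t)) + \<sigma> x * (sin (2 * s) - sin (2 * t))\<bar>"
    by (simp add: prufer_rhs_double_angle right_diff_distrib)
  also have "\<dots> \<le> \<bar>(1 - (\<sigma> x)\<^sup>2 - \<mu>) / 2\<bar> * \<bar>cos (2 * s) - cos (2 * t)\<bar>
      + \<bar>\<sigma> x\<bar> * \<bar>sin (2 * s) - sin (2 * t)\<bar>"
    unfolding abs_mult[symmetric] by (rule abs_triangle_ineq)
  also have "\<dots> \<le> (1 + M\<^sup>2 + \<bar>\<mu>\<bar>) / 2 * (2 * \<bar>s - t\<bar>) + M * (2 * \<bar>s - t\<bar>)"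
  proof (intro add_mono mult_mono cos sin assms)
    show "\<bar>(1 - (\<sigma> x)\<^sup>2 - \<mu>) / 2\<bar> \<le> (1 + M\<^sup>2 + \<bar>\<mu>\<bar>) / 2"
      using sq order_trans[OF zero_le_power2 sq] by (auto simp: abs_if field_simps)
  qed (use assms in auto)
  also have "\<dots> = (1 + 2 * M + M\<^sup>2 + \<bar>\<mu>\<bar>) * \<bar>s - t\<bar>"
    by (simp add: field_simps)
  finally show ?thesis .
qed

lemma continuous_bounded:
  fixes \<sigma> :: "real \<Rightarrow> real"
  assumes "continuous_on {0..L} \<sigma>"
  obtains M where "M \<ge> 0" "\<And>x. x \<in> {0..L} \<Longrightarrow> \<bar>\<sigma> x\<bar> \<le> M"
proof -
  have "bounded (\<sigma> ` {0..L})"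
    by (intro compact_imp_bounded compact_continuous_image assms) auto
  then obtain M where "M > 0" "\<forall>x\<in>\<sigma> ` {0..L}. norm x \<le> M" by (auto simp: bounded_pos)
  then show ?thesis using that[of M] by auto
qed

lemma prufer_angle_exists:
  assumes "L \<ge> 0" "continuous_on {0..L} \<sigma>"
  shows "\<exists>\<theta>. prufer_angle L \<sigma> \<mu> \<theta>"
proof -
  obtain M where M: "M \<ge> 0" "\<And>x. x \<in> {0..L} \<Longrightarrow> \<bar>\<sigma> x\<bar> \<le> M"
    using continuous_bounded[OF assms(2)] by blast
  have "continuous_on ({0..L} \<times> (UNIV :: real set)) (\<lambda>p. \<sigma> (fst p))"
    by (rule continuous_on_compose2[OF assms(2)]) (auto intro: continuous_intros)
  then have "continuous_on ({0..L} \<times> UNIV) (\<lambda>(x, t). prufer_rhs \<sigma> \<mu> x t)"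
    unfolding prufer_rhs_def case_prod_beta by (intro continuous_intros)
  moreover have "1 + 2 * M + M\<^sup>2 + \<bar>\<mu>\<bar> > 0"
    using M(1) by (smt (verit) zero_le_power2)
  ultimately have cont: "continuous_on ({0..L} \<times> UNIV) (\<lambda>(x, t). prufer_rhs \<sigma> \<mu> x t)"
    and K: "1 + 2 * M + M\<^sup>2 + \<bar>\<mu>\<bar> > 0" by blast+
  obtain \<theta> where "\<theta> 0 = 0" "\<And>x. x \<in> {0..L} \<Longrightarrow>
      (\<theta> has_real_derivative prufer_rhs \<sigma> \<mu> x (\<theta> x)) (at x within {0..L})"
  proof (rule initial_value_problem_has_solution[where F = "prufer_rhs \<sigma> \<mu>", OF cont _ K assms(1)])
    show "\<bar>prufer_rhs \<sigma> \<mu> x s - prufer_rhs \<sigma> \<mu> x t\<bar> \<le> (1 + 2 * M + M\<^sup>2 + \<bar>\<mu>\<bar>) * \<bar>s - t\<bar>"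
      if "x \<in> {0..L}" for x s t
      using that by (intro prufer_rhs_lipschitz M)
  qed (rule that)
  then have "prufer_angle L \<sigma> \<mu> \<theta>" by (simp add: prufer_angle_def)
  then show ?thesis by auto
qed

text \<open>Wherever the angle is \<open>0\<close> its derivative is \<open>1\<close>, so it leaves
  \<open>0\<close> upwards and cannot come back.\<close>

lemma prufer_angle_pos:
  assumes "L > 0" "prufer_angle L \<sigma> \<mu> \<theta>" "x \<in> {0<..L}"
  shows "\<theta> x > 0"
proof -
  note \<theta> = prufer_angleD[OF assms(2)]
  have "- \<theta> x < 0"
  proof (rule barrier_not_reached[where f = "\<lambda>x. - \<theta> x" and f' = "\<lambda>x. - prufer_rhs \<sigma> \<mu> x (\<theta> x)"])
    fix x assume "x \<in> {0..L}"
    then show "((\<lambda>x. - \<theta> x) has_real_derivative - prufer_rhs \<sigma> \<mu> x (\<theta> x)) (at x within {0..L})"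
      by (intro DERIV_minus \<theta>)
  next
    fix x assume "- \<theta> x = 0"
    then show "- prufer_rhs \<sigma> \<mu> x (\<theta> x) < 0" by (simp add: prufer_rhs_def)
  qed (use assms \<theta> in auto)
  then show ?thesis by simp
qed

text \<open>At the angle \<open>\<pi> / 2\<close> the derivative is \<open>\<sigma>\<^sup>2 + \<mu> < 0\<close>.
  This is why there are no eigenvalues below \<open>- M\<^sup>2\<close> and why the enumeration of
  the eigenvalues has a first element.\<close>

lemma prufer_angle_less_pi_half:
  assumes "L > 0" "prufer_angle L \<sigma> \<mu> \<theta>"
    and "\<And>x. x \<in> {0..L} \<Longrightarrow> \<bar>\<sigma> x\<bar> \<le> M" "\<mu> < - M\<^sup>2"
  shows "\<theta> L < pi / 2"
proof (rule barrier_not_reached[where f = \<theta> and x = L and f' = "\<lambda>x. prufer_rhs \<sigma> \<mu> x (\<theta> x)"])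
  note \<theta> = prufer_angleD[OF assms(2)]
  show "(\<theta> has_real_derivative prufer_rhs \<sigma> \<mu> x (\<theta> x)) (at x within {0..L})" if "x \<in> {0..L}" for x
    using that by (rule \<theta>)
  show "prufer_rhs \<sigma> \<mu> x (\<theta> x) < 0" if "x \<in> {0..L}" "\<theta> x = pi / 2" for x
  proof -
    have "(\<sigma> x)\<^sup>2 \<le> M\<^sup>2" using assms(3)[OF that(1)] by (simp add: abs_le_square_iff[symmetric])
    then show ?thesis unfolding prufer_rhs_def that(2) using assms(4) by simp
  qed
qed (use assms prufer_angleD[OF assms(2)] in auto)

text \<open>Raising \<open>\<mu>\<close> by \<open>\<nu> - \<mu>\<close> adds
  \<open>(\<nu> - \<mu>) sin\<^sup>2 \<theta> \<ge> 0\<close> to the right-hand side, and the rest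
  of the difference is Lipschitz in the angle.\<close>

lemma prufer_angle_mono:
  assumes \<theta>1: "prufer_angle L \<sigma> \<mu> \<theta>1" and \<theta>2: "prufer_angle L \<sigma> \<nu> \<theta>2" and "\<mu> \<le> \<nu>"
    and M: "\<And>x. x \<in> {0..L} \<Longrightarrow> \<bar>\<sigma> x\<bar> \<le> M" and x: "x \<in> {0..L}"
  shows "\<theta>1 x \<le> \<theta>2 x"
proof -
  define K where "K = 1 + 2 * M + M\<^sup>2 + \<bar>\<nu>\<bar>"
  have "\<theta>2 x - \<theta>1 x \<ge> 0"
  proof (rule differential_inequality_nonneg[where D = "\<lambda>x. \<theta>2 x - \<theta>1 x"
        and D' = "\<lambda>x. prufer_rhs \<sigma> \<nu> x (\<theta>2 x) - prufer_rhs \<sigma> \<mu> x (\<theta>1 x)"])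
    fix x assume x: "x \<in> {0..L}"
    show "((\<lambda>x. \<theta>2 x - \<theta>1 x) has_real_derivative
        prufer_rhs \<sigma> \<nu> x (\<theta>2 x) - prufer_rhs \<sigma> \<mu> x (\<theta>1 x)) (at x within {0..L})"
      by (intro DERIV_diff prufer_angleD[OF \<theta>1] prufer_angleD[OF \<theta>2] x)
    have "prufer_rhs \<sigma> \<nu> x (\<theta>1 x) - prufer_rhs \<sigma> \<mu> x (\<theta>1 x) = (\<nu> - \<mu>) * (sin (\<theta>1 x))\<^sup>2"
      by (simp add: prufer_rhs_def left_diff_distrib)
    also have "\<dots> \<ge> 0" using \<open>\<mu> \<le> \<nu>\<close> by simp
    finally show "prufer_rhs \<sigma> \<nu> x (\<theta>2 x) - prufer_rhs \<sigma> \<mu> x (\<theta>1 x)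
        \<ge> - (K * \<bar>\<theta>2 x - \<theta>1 x\<bar>)"
      using prufer_rhs_lipschitz[of \<sigma> x M \<nu> "\<theta>2 x" "\<theta>1 x", OF M[OF x]] unfolding K_def[symmetric]
      by linarith
  qed (use prufer_angleD(1)[OF \<theta>1] prufer_angleD(1)[OF \<theta>2] x in auto)
  then show ?thesis by simp
qed

text \<open>If the two angles met at \<open>L\<close>, the nondecreasing function
  \<open>exp (K x) (\<theta>2 x - \<theta>1 x)\<close> would vanish identically; then the added term
  \<open>(\<nu> - \<mu>) sin\<^sup>2 \<theta>1\<close> would vanish as well, although
  \<open>\<theta>1\<close> lies strictly between \<open>0\<close> and \<open>\<pi>\<close> just
  after the start.\<close>

lemma prufer_angle_strict_mono:
  assumes "L > 0" and \<theta>1: "prufer_angle L \<sigma> \<mu> \<theta>1" and \<theta>2: "prufer_angle L \<sigma> \<nu> \<theta>2" and "\<mu> < \<nu>"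
    and M: "\<And>x. x \<in> {0..L} \<Longrightarrow> \<bar>\<sigma> x\<bar> \<le> M"
  shows "\<theta>1 L < \<theta>2 L"
proof (rule ccontr)
  assume nless: "\<not> \<theta>1 L < \<theta>2 L"
  define K where "K = 1 + 2 * M + M\<^sup>2 + \<bar>\<nu>\<bar>"
  define D where "D x = \<theta>2 x - \<theta>1 x" for x
  define D' where "D' x = prufer_rhs \<sigma> \<nu> x (\<theta>2 x) - prufer_rhs \<sigma> \<mu> x (\<theta>1 x)" for x
  define E where "E x = exp (K * x) * D x" for x
  have D_nonneg: "D x \<ge> 0" if "x \<in> {0..L}" for x
    using prufer_angle_mono[OF \<theta>1 \<theta>2 _ M that] \<open>\<mu> < \<nu>\<close> by (simp add: D_def)
  have D_deriv: "(D has_real_derivative D' x) (at x within {0..L})" if "x \<in> {0..L}" for x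
    unfolding D_def D'_def
    by (intro DERIV_diff prufer_angleD[OF \<theta>1] prufer_angleD[OF \<theta>2] that)
  have D'_lower: "D' x + K * D x \<ge> (\<nu> - \<mu>) * (sin (\<theta>1 x))\<^sup>2" if "x \<in> {0..L}" for x
  proof -
    have "prufer_rhs \<sigma> \<nu> x (\<theta>1 x) - prufer_rhs \<sigma> \<mu> x (\<theta>1 x) = (\<nu> - \<mu>) * (sin (\<theta>1 x))\<^sup>2"
      by (simp add: prufer_rhs_def left_diff_distrib)
    then show ?thesis
      using prufer_rhs_lipschitz[of \<sigma> x M \<nu> "\<theta>2 x" "\<theta>1 x", OF M[OF that]] D_nonneg[OF that]
      unfolding D'_def D_def K_def[symmetric] by (simp add: abs_le_iff)
  qed
  have E_deriv: "(E has_real_derivative exp (K * x) * (D' x + K * D x)) (at x within {0..L})"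
    if "x \<in> {0..L}" for x
    unfolding E_def using that by (auto intro!: derivative_eq_intros D_deriv simp: algebra_simps)
  have E_mono: "E a \<le> E b" if "0 \<le> a" "a \<le> b" "b \<le> L" for a b
  proof (rule nondecreasing_within[where f = E and f' = "\<lambda>x. exp (K * x) * (D' x + K * D x)"])
    fix x assume "x \<in> {a<..<b}"
    then have "x \<in> {0..L}" using that by auto
    then have "D' x + K * D x \<ge> (\<nu> - \<mu>) * (sin (\<theta>1 x))\<^sup>2" by (rule D'_lower)
    moreover have "(\<nu> - \<mu>) * (sin (\<theta>1 x))\<^sup>2 \<ge> 0" using \<open>\<mu> < \<nu>\<close> by simp
    ultimately show "exp (K * x) * (D' x + K * D x) \<ge> 0" by simp
  qed (use that in \<open>auto intro: DERIV_subset[OF E_deriv]\<close>)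
  have "D L = 0" using nless D_nonneg[of L] \<open>L > 0\<close> by (simp add: D_def)
  then have E_zero: "E x = 0" if "x \<in> {0..L}" for x
    using E_mono[of 0 x] E_mono[of x L] that prufer_angleD(1)[OF \<theta>1] prufer_angleD(1)[OF \<theta>2]
    by (simp add: E_def D_def)
  have sin_zero: "sin (\<theta>1 x) = 0" if "x \<in> {0<..<L}" for x
  proof -
    have interior: "at x within {0..L} = at x"
      using that by (intro at_within_Icc_at) auto
    have "(E has_real_derivative 0) (at x within {0..L})"
      by (rule has_field_derivative_transform_within[of "\<lambda>_. 0" _ _ _ 1]) (use that E_zero in auto)
    moreover have "(E has_real_derivative exp (K * x) * (D' x + K * D x)) (at x within {0..L})"
      using that by (intro E_deriv) auto
    ultimately have "exp (K * x) * (D' x + K * D x) = 0"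
      unfolding interior by (intro DERIV_unique)
    then have "(\<nu> - \<mu>) * (sin (\<theta>1 x))\<^sup>2 \<le> 0"
      using D'_lower[of x] that by simp
    then show ?thesis using \<open>\<mu> < \<nu>\<close> by (simp add: mult_le_0_iff)
  qed
  have "(\<theta>1 \<longlongrightarrow> \<theta>1 0) (at 0 within {0..L})"
    using prufer_angleD(3)[OF \<theta>1] \<open>L > 0\<close> unfolding continuous_on_def by auto
  then have "\<forall>\<^sub>F t in at 0 within {0..L}. \<theta>1 t < pi"
    using prufer_angleD(1)[OF \<theta>1] by (intro order_tendstoD(2)[of \<theta>1 "\<theta>1 0"]) auto
  then obtain d where d: "d > 0" "\<And>t. t \<in> {0..L} \<Longrightarrow> t \<noteq> 0 \<Longrightarrow> \<bar>t\<bar> < d \<Longrightarrow> \<theta>1 t < pi"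
    unfolding eventually_at by (auto simp: dist_real_def)
  define t where "t = min (L / 2) (d / 2)"
  have t: "t \<in> {0<..<L}" "\<theta>1 t < pi"
    using d(1) \<open>L > 0\<close> by (auto simp: t_def intro!: d(2))
  have "sin (\<theta>1 t) > 0"
    using prufer_angle_pos[OF \<open>L > 0\<close> \<theta>1, of t] t by (intro sin_gt_zero) auto
  then show False using sin_zero[OF t(1)] by simp
qed

text \<open>Gronwall's inequality for \<open>D = \<theta>2 - \<theta>1\<close>, which satisfies
  \<open>D' \<le> K D + (\<nu> - \<mu>)\<close>.\<close>

lemma prufer_angle_lipschitz_in_energy:
  assumes "L > 0" and \<theta>1: "prufer_angle L \<sigma> \<mu> \<theta>1" and \<theta>2: "prufer_angle L \<sigma> \<nu> \<theta>2" and "\<mu> \<le> \<nu>"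
    and M: "\<And>x. x \<in> {0..L} \<Longrightarrow> \<bar>\<sigma> x\<bar> \<le> M" "M \<ge> 0"
  shows "\<theta>2 L - \<theta>1 L \<le> exp ((1 + 2 * M + M\<^sup>2 + \<bar>\<nu>\<bar>) * L) * L * (\<nu> - \<mu>)"
proof -
  define K where "K = 1 + 2 * M + M\<^sup>2 + \<bar>\<nu>\<bar>"
  have "K \<ge> 0" using M(2) by (simp add: K_def)
  define D where "D x = \<theta>2 x - \<theta>1 x" for x
  define D' where "D' x = prufer_rhs \<sigma> \<nu> x (\<theta>2 x) - prufer_rhs \<sigma> \<mu> x (\<theta>1 x)" for x
  define E where "E x = (\<nu> - \<mu>) * x - exp (- (K * x)) * D x" for x
  have D_deriv: "(D has_real_derivative D' x) (at x within {0..L})" if "x \<in> {0..L}" for x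
    unfolding D_def D'_def
    by (intro DERIV_diff prufer_angleD[OF \<theta>1] prufer_angleD[OF \<theta>2] that)
  have "E 0 \<le> E L"
  proof (rule nondecreasing_within[where f = E and f' = "\<lambda>x. (\<nu> - \<mu>) - exp (- (K * x)) * (D' x - K * D x)"])
    fix x assume "x \<in> {0..L}"
    then show "(E has_real_derivative (\<nu> - \<mu>) - exp (- (K * x)) * (D' x - K * D x))
        (at x within {0..L})"
      unfolding E_def by (auto intro!: derivative_eq_intros D_deriv simp: algebra_simps)
  next
    fix x assume "x \<in> {0<..<L}"
    then have x: "x \<in> {0..L}" by simp
    have "prufer_rhs \<sigma> \<nu> x (\<theta>1 x) - prufer_rhs \<sigma> \<mu> x (\<theta>1 x) = (\<nu> - \<mu>) * (sin (\<theta>1 x))\<^sup>2"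
      by (simp add: prufer_rhs_def left_diff_distrib)
    also have "\<dots> \<le> (\<nu> - \<mu>) * 1"
      using \<open>\<mu> \<le> \<nu>\<close> by (intro mult_left_mono) (auto simp: abs_square_le_1)
    finally have "D' x - K * D x \<le> \<nu> - \<mu>"
      using prufer_rhs_lipschitz[of \<sigma> x M \<nu> "\<theta>2 x" "\<theta>1 x", OF M(1)[OF x]]
        prufer_angle_mono[OF \<theta>1 \<theta>2 \<open>\<mu> \<le> \<nu>\<close> M(1) x]
      unfolding D'_def D_def K_def[symmetric] by (simp add: abs_le_iff)
    then have "exp (- (K * x)) * (D' x - K * D x) \<le> exp (- (K * x)) * (\<nu> - \<mu>)"
      by (intro mult_left_mono) auto
    also have "\<dots> \<le> 1 * (\<nu> - \<mu>)"
      using x \<open>K \<ge> 0\<close> \<open>\<mu> \<le> \<nu>\<close> by (intro mult_right_mono) auto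
    finally show "(\<nu> - \<mu>) - exp (- (K * x)) * (D' x - K * D x) \<ge> 0" by simp
  qed (use \<open>L > 0\<close> in simp)
  then have "exp (- (K * L)) * D L \<le> (\<nu> - \<mu>) * L"
    using prufer_angleD(1)[OF \<theta>1] prufer_angleD(1)[OF \<theta>2] by (simp add: E_def D_def)
  then have "exp (K * L) * (exp (- (K * L)) * D L) \<le> exp (K * L) * ((\<nu> - \<mu>) * L)"
    by (intro mult_left_mono) auto
  also have "exp (K * L) * (exp (- (K * L)) * D L) = D L"
    by (simp flip: mult.assoc exp_add)
  finally show ?thesis
    by (simp only: D_def K_def mult.assoc mult.commute[of "\<nu> - \<mu>"])
qed

text \<open>The Lipschitz constant in the energy grows with the energy, hence only local uniformity and
  continuity are claimed.\<close>

lemma prufer_angle_at_endpoint_continuous: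
  assumes "L > 0" and \<Theta>: "\<And>\<mu>. prufer_angle L \<sigma> \<mu> (\<Theta> \<mu>)"
    and M: "\<And>x. x \<in> {0..L} \<Longrightarrow> \<bar>\<sigma> x\<bar> \<le> M" "M \<ge> 0"
  shows "isCont (\<lambda>\<mu>. \<Theta> \<mu> L) \<mu>"
proof -
  define C where "C = exp ((1 + 2 * M + M\<^sup>2 + (\<bar>\<mu>\<bar> + 1)) * L) * L"
  have one_sided: "0 \<le> \<Theta> b L - \<Theta> a L \<and> \<Theta> b L - \<Theta> a L \<le> C * (b - a)"
    if "a \<le> b" "\<bar>b\<bar> \<le> \<bar>\<mu>\<bar> + 1" for a b
  proof
    show "0 \<le> \<Theta> b L - \<Theta> a L"
      using prufer_angle_mono[OF \<Theta> \<Theta> that(1) M(1)] \<open>L > 0\<close> by simp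
    have "\<Theta> b L - \<Theta> a L \<le> exp ((1 + 2 * M + M\<^sup>2 + \<bar>b\<bar>) * L) * L * (b - a)"
      by (rule prufer_angle_lipschitz_in_energy[OF \<open>L > 0\<close> \<Theta> \<Theta> that(1) M])
    also have "\<dots> \<le> C * (b - a)"
      unfolding C_def using that \<open>L > 0\<close> by (intro mult_right_mono) auto
    finally show "\<Theta> b L - \<Theta> a L \<le> C * (b - a)" .
  qed
  have near: "\<bar>\<Theta> \<nu> L - \<Theta> \<mu> L\<bar> \<le> C * \<bar>\<nu> - \<mu>\<bar>" if "\<bar>\<nu> - \<mu>\<bar> < 1" for \<nu>
    using one_sided[of \<mu> \<nu>] one_sided[of \<nu> \<mu>] that by (cases "\<mu> \<le> \<nu>") auto
  have "((\<lambda>\<nu>. \<Theta> \<nu> L - \<Theta> \<mu> L) \<longlongrightarrow> 0) (at \<mu>)"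
  proof (rule Lim_null_comparison)
    show "\<forall>\<^sub>F \<nu> in at \<mu>. norm (\<Theta> \<nu> L - \<Theta> \<mu> L) \<le> C * \<bar>\<nu> - \<mu>\<bar>"
      unfolding eventually_at using near by (intro exI[of _ 1]) (auto simp: dist_real_def)
    show "((\<lambda>\<nu>. C * \<bar>\<nu> - \<mu>\<bar>) \<longlongrightarrow> 0) (at \<mu>)"
      by (auto intro!: tendsto_eq_intros)
  qed
  then show ?thesis unfolding isCont_def by (rule LIM_zero_cancel)
qed

section \<open>The Prufer angle in the scale of the wave number\<close>

text \<open>The angle \<open>\<psi>\<close> is the polar angle of \<open>(u, k y)\<close>, so that
  \<open>tan \<psi> = k tan \<theta>\<close>. The branch that stays near \<open>\<theta>\<close> is
  written as \<open>\<psi> = \<theta> + arctan (num / den)\<close>, where \<open>num / den\<close>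
  is \<open>tan (\<psi> - \<theta>)\<close> by the addition theorem; since \<open>den > 0\<close>,
  this formula is smooth and needs no case distinction at the poles of the tangent. In the new scale
  the large parameter \<open>k\<close> enters the equation only as the constant speed and as the
  damping of \<open>\<sigma>\<^sup>2\<close>.\<close>

lemma rescaled_prufer_angle:
  assumes \<theta>: "prufer_angle L \<sigma> (k\<^sup>2) \<theta>" and "k > 0"
  obtains \<psi> where "\<psi> 0 = 0"
    "\<And>x. x \<in> {0..L} \<Longrightarrow> (\<psi> has_real_derivative
        k + \<sigma> x * sin (2 * \<psi> x) + (\<sigma> x)\<^sup>2 / k * (sin (\<psi> x))\<^sup>2) (at x within {0..L})"
    "\<And>x. \<bar>\<psi> x - \<theta> x\<bar> \<le> pi / 2"
    "\<And>x. sin (\<theta> x) = 0 \<Longrightarrow> \<psi> x = \<theta> x"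
proof -
  define num where "num t = (k - 1) * sin t * cos t" for t :: real
  define den where "den t = (cos t)\<^sup>2 + k * (sin t)\<^sup>2" for t :: real
  \<comment> \<open>\<open>sqrt (Q t)\<close> is the length of the vector \<open>(cos t, k sin t)\<close>, whose polar angle is \<open>g t\<close>.\<close>
  define Q where "Q t = (cos t)\<^sup>2 + k\<^sup>2 * (sin t)\<^sup>2" for t :: real
  have pos: "den t > 0" "Q t > 0" for t
  proof -
    have "(cos t)\<^sup>2 + c * (sin t)\<^sup>2 > 0" if "c > 0" for c
    proof (cases "sin t = 0")
      case True
      then show ?thesis using sin_cos_squared_add[of t] by simp
    next
      case False
      then show ?thesis using that by (intro add_nonneg_pos) auto
    qed
    then show "den t > 0" "Q t > 0" using \<open>k > 0\<close> by (simp_all add: den_def Q_def)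
  qed
  have norm_eq: "(den t)\<^sup>2 + (num t)\<^sup>2 = Q t" for t
  proof -
    have "(den t)\<^sup>2 + (num t)\<^sup>2 = Q t * ((sin t)\<^sup>2 + (cos t)\<^sup>2)"
      unfolding den_def num_def Q_def by algebra
    then show ?thesis by simp
  qed
  define g where "g t = t + arctan (num t / den t)" for t
  have g_deriv: "(g has_real_derivative k / Q t) (at t)" for t
  proof -
    have num': "(num has_real_derivative (k - 1) * ((cos t)\<^sup>2 - (sin t)\<^sup>2)) (at t)"
      unfolding num_def by (auto intro!: derivative_eq_intros simp: power2_eq_square algebra_simps)
    have den': "(den has_real_derivative 2 * (k - 1) * sin t * cos t) (at t)"
      unfolding den_def by (auto intro!: derivative_eq_intros simp: power2_eq_square algebra_simps)
    have frac: "((\<lambda>t. num t / den t) has_real_derivative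
        ((k - 1) * ((cos t)\<^sup>2 - (sin t)\<^sup>2) * den t - num t * (2 * (k - 1) * sin t * cos t)) / (den t * den t)) (at t)"
      using pos(1)[of t] by (intro DERIV_divide num' den') auto
    have poly: "(k - 1) * ((cos t)\<^sup>2 - (sin t)\<^sup>2) * den t - num t * (2 * (k - 1) * sin t * cos t) = k - Q t"
    proof -
      have "(k - 1) * ((cos t)\<^sup>2 - (sin t)\<^sup>2) * den t - num t * (2 * (k - 1) * sin t * cos t)
          = (k - 1) * ((cos t)\<^sup>2 - k * (sin t)\<^sup>2) * ((sin t)\<^sup>2 + (cos t)\<^sup>2)"
        unfolding den_def num_def by algebra
      also have "\<dots> = k * ((sin t)\<^sup>2 + (cos t)\<^sup>2) - Q t"
        unfolding sin_cos_squared_add Q_def cos_squared_eq by algebra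
      finally show ?thesis by simp
    qed
    have "(g has_real_derivative 1 + (k - Q t) / (den t * den t) / (1 + (num t / den t)\<^sup>2)) (at t)"
      unfolding g_def using DERIV_add[OF DERIV_ident DERIV_chain2[OF DERIV_arctan frac]]
      unfolding poly by (simp add: divide_inverse mult.commute)
    also have "1 + (num t / den t)\<^sup>2 = Q t / (den t * den t)"
      using pos(1)[of t] by (simp add: norm_eq[symmetric] field_simps power2_eq_square)
    also have "1 + (k - Q t) / (den t * den t) / (Q t / (den t * den t)) = k / Q t"
      using pos[of t] by (simp add: field_simps)
    finally show ?thesis .
  qed
  have root: "sqrt (1 + (num t / den t)\<^sup>2) = sqrt (Q t) / den t" for t
  proof -
    have "1 + (num t / den t)\<^sup>2 = Q t / (den t)\<^sup>2"
      using pos(1)[of t] by (simp add: norm_eq[symmetric] field_simps)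
    then show ?thesis using pos(1)[of t] by (simp add: real_sqrt_divide)
  qed
  have sin_g: "sin (g t) = k * sin t / sqrt (Q t)" for t
  proof -
    have "sin (g t) = (sin t * den t + cos t * num t) / sqrt (Q t)"
      unfolding g_def sin_add sin_arctan cos_arctan root using pos[of t] by (simp add: field_simps)
    also have "sin t * den t + cos t * num t = k * sin t * ((sin t)\<^sup>2 + (cos t)\<^sup>2)"
      unfolding den_def num_def by algebra
    finally show ?thesis by simp
  qed
  have cos_g: "cos (g t) = cos t / sqrt (Q t)" for t
  proof -
    have "cos (g t) = (cos t * den t - sin t * num t) / sqrt (Q t)"
      unfolding g_def cos_add sin_arctan cos_arctan root using pos[of t] by (simp add: field_simps)
    also have "cos t * den t - sin t * num t = cos t * ((sin t)\<^sup>2 + (cos t)\<^sup>2)"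
      unfolding den_def num_def by algebra
    finally show ?thesis by simp
  qed
  show ?thesis
  proof (rule that[of "\<lambda>x. g (\<theta> x)"])
    show "g (\<theta> 0) = 0" by (simp add: g_def num_def prufer_angleD(1)[OF \<theta>])
    show "\<bar>g (\<theta> x) - \<theta> x\<bar> \<le> pi / 2" for x
      using arctan_bounded[of "num (\<theta> x) / den (\<theta> x)"] unfolding g_def by linarith
    show "g (\<theta> x) = \<theta> x" if "sin (\<theta> x) = 0" for x
      using that by (simp add: g_def num_def)
    fix x assume x: "x \<in> {0..L}"
    define t where "t = \<theta> x"
    have "((\<lambda>x. g (\<theta> x)) has_real_derivative k / Q t * prufer_rhs \<sigma> (k\<^sup>2) x t) (at x within {0..L})"
      unfolding t_def
      using DERIV_chain2[OF g_deriv prufer_angleD(2)[OF \<theta> x]] .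
    also have "prufer_rhs \<sigma> (k\<^sup>2) x t = Q t + 2 * \<sigma> x * sin t * cos t + (\<sigma> x)\<^sup>2 * (sin t)\<^sup>2"
      unfolding prufer_rhs_def Q_def by algebra
    also have "k / Q t * \<dots> = k + \<sigma> x * sin (2 * g t) + (\<sigma> x)\<^sup>2 / k * (sin (g t))\<^sup>2"
    proof -
      have S: "sin (2 * g t) = 2 * k * sin t * cos t / Q t"
        unfolding sin_double sin_g cos_g using pos(2)[of t] by (simp add: field_simps)
      have S2: "(sin (g t))\<^sup>2 = k\<^sup>2 * (sin t)\<^sup>2 / Q t"
        unfolding sin_g using pos(2)[of t] by (simp add: power_divide power_mult_distrib)
      show ?thesis
        unfolding S S2 using pos(2)[of t] \<open>k > 0\<close> by (simp add: field_simps power2_eq_square)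
    qed
    finally show "((\<lambda>x. g (\<theta> x)) has_real_derivative
        k + \<sigma> x * sin (2 * g (\<theta> x)) + (\<sigma> x)\<^sup>2 / k * (sin (g (\<theta> x)))\<^sup>2) (at x within {0..L})"
      by (simp add: t_def)
  qed
qed

text \<open>The crude form of the asymptotics: without using oscillation, \<open>\<psi>\<close> runs at speed
  \<open>k\<close> up to a bounded error.\<close>

lemma rescaled_prufer_angle_growth:
  fixes \<psi> :: "real \<Rightarrow> real"
  assumes "L > 0" "k \<ge> 1" "\<psi> 0 = 0"
    and deriv: "\<And>x. x \<in> {0..L} \<Longrightarrow> (\<psi> has_real_derivative
        k + \<sigma> x * sin (2 * \<psi> x) + (\<sigma> x)\<^sup>2 / k * (sin (\<psi> x))\<^sup>2) (at x within {0..L})"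
    and M: "\<And>x. x \<in> {0..L} \<Longrightarrow> \<bar>\<sigma> x\<bar> \<le> M" "M \<ge> 0"
  shows "\<bar>\<psi> L - k * L\<bar> \<le> (M + M\<^sup>2) * L"
    and "x \<in> {0..L} \<Longrightarrow> \<bar>\<sigma> x * sin (2 * \<psi> x) + (\<sigma> x)\<^sup>2 / k * (sin (\<psi> x))\<^sup>2\<bar> \<le> M + M\<^sup>2"
proof -
  have bound: "\<bar>\<sigma> x * sin (2 * \<psi> x) + (\<sigma> x)\<^sup>2 / k * (sin (\<psi> x))\<^sup>2\<bar> \<le> M + M\<^sup>2"
    if x: "x \<in> {0..L}" for x
  proof -
    have "\<bar>\<sigma> x * sin (2 * \<psi> x)\<bar> \<le> M * 1"
      unfolding abs_mult using M(1)[OF x] M(2) by (intro mult_mono) auto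
    moreover have "(\<sigma> x)\<^sup>2 / k * (sin (\<psi> x))\<^sup>2 \<le> M\<^sup>2 * 1"
    proof (intro mult_mono)
      have "(\<sigma> x)\<^sup>2 / k \<le> (\<sigma> x)\<^sup>2 / 1" using \<open>k \<ge> 1\<close> by (intro divide_left_mono) auto
      also have "\<dots> \<le> M\<^sup>2" using M(1)[OF x] by (simp add: abs_le_square_iff[symmetric])
      finally show "(\<sigma> x)\<^sup>2 / k \<le> M\<^sup>2" .
    qed (auto simp: abs_square_le_1)
    moreover have "(\<sigma> x)\<^sup>2 / k * (sin (\<psi> x))\<^sup>2 \<ge> 0" using \<open>k \<ge> 1\<close> by simp
    ultimately show ?thesis by (simp add: abs_le_iff)
  qed
  show "\<bar>\<sigma> x * sin (2 * \<psi> x) + (\<sigma> x)\<^sup>2 / k * (sin (\<psi> x))\<^sup>2\<bar> \<le> M + M\<^sup>2" if "x \<in> {0..L}" for x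
    using that by (rule bound)
  have "\<bar>(\<psi> L - k * L) - (\<psi> 0 - k * 0)\<bar> \<le> (M + M\<^sup>2) * (L - 0)"
  proof (rule increment_le_within[where f = "\<lambda>x. \<psi> x - k * x"
        and f' = "\<lambda>x. \<sigma> x * sin (2 * \<psi> x) + (\<sigma> x)\<^sup>2 / k * (sin (\<psi> x))\<^sup>2"])
    fix x assume "x \<in> {0..L}"
    from DERIV_diff[OF deriv[OF this] DERIV_cmult[OF DERIV_ident, of k]]
    show "((\<lambda>x. \<psi> x - k * x) has_real_derivative
        \<sigma> x * sin (2 * \<psi> x) + (\<sigma> x)\<^sup>2 / k * (sin (\<psi> x))\<^sup>2) (at x within {0..L})"
      by simp
  qed (use bound \<open>L > 0\<close> in auto)
  then show "\<bar>\<psi> L - k * L\<bar> \<le> (M + M\<^sup>2) * L" using \<open>\<psi> 0 = 0\<close> by simp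
qed

lemma prufer_angle_unbounded:
  assumes "L > 0" and M: "\<And>x. x \<in> {0..L} \<Longrightarrow> \<bar>\<sigma> x\<bar> \<le> M" "M \<ge> 0"
  shows "\<exists>\<mu>. \<forall>\<theta>. prufer_angle L \<sigma> \<mu> \<theta> \<longrightarrow> \<theta> L > T"
proof -
  \<comment> \<open>Large enough that even the slowest possible growth of \<open>\<psi>\<close> exceeds \<open>T + \<pi> / 2\<close>; the \<open>\<pi> / 2\<close> pays for \<open>\<bar>\<psi> - \<theta>\<bar>\<close>.\<close>
  define k where "k = max 1 ((T + pi / 2) / L + (M + M\<^sup>2) + 1)"
  have "k \<ge> 1" by (simp add: k_def)
  then have "k > 0" by simp
  have "\<theta> L > T" if \<theta>: "prufer_angle L \<sigma> (k\<^sup>2) \<theta>" for \<theta>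
  proof -
    obtain \<psi> where \<psi>: "\<psi> 0 = 0"
      "\<And>x. x \<in> {0..L} \<Longrightarrow> (\<psi> has_real_derivative
        k + \<sigma> x * sin (2 * \<psi> x) + (\<sigma> x)\<^sup>2 / k * (sin (\<psi> x))\<^sup>2) (at x within {0..L})"
      "\<And>x. \<bar>\<psi> x - \<theta> x\<bar> \<le> pi / 2" "\<And>x. sin (\<theta> x) = 0 \<Longrightarrow> \<psi> x = \<theta> x"
      by (rule rescaled_prufer_angle[OF \<theta> \<open>k > 0\<close>]) (rule that)
    have growth: "\<bar>\<psi> L - k * L\<bar> \<le> (M + M\<^sup>2) * L"
      by (rule rescaled_prufer_angle_growth(1)[OF \<open>L > 0\<close> \<open>k \<ge> 1\<close> \<psi>(1,2) M])
    have "((T + pi / 2) / L + (M + M\<^sup>2) + 1) * L \<le> k * L"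
      unfolding k_def using \<open>L > 0\<close> by (intro mult_right_mono) auto
    moreover have "(T + pi / 2) / L * L = T + pi / 2" using \<open>L > 0\<close> by simp
    ultimately have "T + pi / 2 + (M + M\<^sup>2) * L + L \<le> k * L"
      by (simp only: distrib_right mult_1_left)
    then show ?thesis using growth \<psi>(3)[of L] \<open>L > 0\<close> unfolding abs_le_iff by linarith
  qed
  then show ?thesis by auto
qed

text \<open>An integration by parts in disguise: with \<open>S\<close> and \<open>C\<close> for the two
  integrals and \<open>\<phi> = \<psi> - q x\<close>, the corrected phase
  \<open>\<phi> - S cos 2\<phi> - C sin 2\<phi>\<close> has the derivative \<open>k - q\<close> up
  to terms that contain a factor \<open>S\<close>, \<open>C\<close> or \<open>1 / k\<close>.
  Comparing with the boundary values \<open>\<phi>(0) = \<phi>(L) = 0\<close> gives the bound.\<close>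

lemma wave_number_estimate:
  fixes \<sigma> :: "real \<Rightarrow> real" and n :: nat
  assumes "L > 0" and \<theta>: "prufer_angle L \<sigma> (k\<^sup>2) \<theta>" and "k \<ge> 1" and "\<theta> L = real n * pi"
    and cont: "continuous_on {0..L} \<sigma>"
    and M: "\<And>x. x \<in> {0..L} \<Longrightarrow> \<bar>\<sigma> x\<bar> \<le> M" "M \<ge> 0"
    and q: "q = real n * pi / L"
    and sin_int: "\<And>x. x \<in> {0..L} \<Longrightarrow> \<bar>integral {0..x} (\<lambda>s. \<sigma> s * sin (2 * q * s))\<bar> \<le> A"
    and cos_int: "\<And>x. x \<in> {0..L} \<Longrightarrow> \<bar>integral {0..x} (\<lambda>s. \<sigma> s * cos (2 * q * s))\<bar> \<le> A"
  shows "\<bar>k - q\<bar> \<le> M + M\<^sup>2" and "\<bar>k - q\<bar> * L \<le> A + (M\<^sup>2 / k + 8 * A * (M + M\<^sup>2)) * L"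
proof -
  define D where "D = M + M\<^sup>2"
  have "A \<ge> 0" using sin_int[of 0] \<open>L > 0\<close> by simp
  have "D \<ge> 0" using M(2) by (simp add: D_def)
  have "k > 0" using \<open>k \<ge> 1\<close> by simp
  obtain \<psi> where \<psi>0: "\<psi> 0 = 0"
    and \<psi>': "\<And>x. x \<in> {0..L} \<Longrightarrow> (\<psi> has_real_derivative
      k + \<sigma> x * sin (2 * \<psi> x) + (\<sigma> x)\<^sup>2 / k * (sin (\<psi> x))\<^sup>2) (at x within {0..L})"
    and "\<And>x. \<bar>\<psi> x - \<theta> x\<bar> \<le> pi / 2" and \<psi>\<theta>: "\<And>x. sin (\<theta> x) = 0 \<Longrightarrow> \<psi> x = \<theta> x"
    by (rule rescaled_prufer_angle[OF \<theta> \<open>k > 0\<close>]) (rule that)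
  have \<psi>L: "\<psi> L = q * L"
    using \<psi>\<theta>[of L] \<open>\<theta> L = real n * pi\<close> \<open>L > 0\<close> by (simp add: q)
  have "\<bar>\<psi> L - k * L\<bar> \<le> D * L" unfolding D_def
    by (rule rescaled_prufer_angle_growth(1)[OF \<open>L > 0\<close> \<open>k \<ge> 1\<close> \<psi>0 \<psi>' M])
  then have "\<bar>q - k\<bar> * L \<le> D * L"
    using \<open>L > 0\<close> by (simp add: \<psi>L abs_mult flip: left_diff_distrib)
  then show kq: "\<bar>k - q\<bar> \<le> M + M\<^sup>2" using \<open>L > 0\<close> by (simp add: D_def abs_minus_commute)
  define \<phi> where "\<phi> x = \<psi> x - q * x" for x
  define S where "S x = integral {0..x} (\<lambda>s. \<sigma> s * sin (2 * q * s))" for x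
  define C where "C x = integral {0..x} (\<lambda>s. \<sigma> s * cos (2 * q * s))" for x
  define \<phi>' where "\<phi>' x = (k - q) + (\<sigma> x * sin (2 * \<psi> x) + (\<sigma> x)\<^sup>2 / k * (sin (\<psi> x))\<^sup>2)" for x
  define E where "E x = \<phi> x - S x * cos (2 * \<phi> x) - C x * sin (2 * \<phi> x) - (k - q) * x" for x
  define E' where "E' x = (\<sigma> x)\<^sup>2 / k * (sin (\<psi> x))\<^sup>2
      + 2 * \<phi>' x * (S x * sin (2 * \<phi> x) - C x * cos (2 * \<phi> x))" for x
  have S': "(S has_real_derivative \<sigma> x * sin (2 * q * x)) (at x within {0..L})"
    and C': "(C has_real_derivative \<sigma> x * cos (2 * q * x)) (at x within {0..L})"
    if "x \<in> {0..L}" for x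
    unfolding S_def C_def
    by (intro integral_has_real_derivative that continuous_intros cont)+
  have \<phi>_deriv: "(\<phi> has_real_derivative \<phi>' x) (at x within {0..L})" if "x \<in> {0..L}" for x
    using DERIV_diff[OF \<psi>'[OF that] DERIV_cmult[OF DERIV_ident, of q]]
    by (simp add: \<phi>_def[abs_def] \<phi>'_def algebra_simps)
  have E_deriv: "(E has_real_derivative E' x) (at x within {0..L})" if x: "x \<in> {0..L}" for x
  proof -
    have sin_split: "sin (2 * \<psi> x) = sin (2 * q * x) * cos (2 * \<phi> x) + cos (2 * q * x) * sin (2 * \<phi> x)"
      by (simp add: \<phi>_def flip: sin_add)
    have "(E has_real_derivative \<phi>' x
        - (\<sigma> x * sin (2 * q * x) * cos (2 * \<phi> x) + S x * (- sin (2 * \<phi> x) * (2 * \<phi>' x)))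
        - (\<sigma> x * cos (2 * q * x) * sin (2 * \<phi> x) + C x * (cos (2 * \<phi> x) * (2 * \<phi>' x)))
        - (k - q)) (at x within {0..L})"
      unfolding E_def
      by (rule derivative_eq_intros S'[OF x] C'[OF x] \<phi>_deriv[OF x] refl | simp)+
    also have "\<phi>' x
        - (\<sigma> x * sin (2 * q * x) * cos (2 * \<phi> x) + S x * (- sin (2 * \<phi> x) * (2 * \<phi>' x)))
        - (\<sigma> x * cos (2 * q * x) * sin (2 * \<phi> x) + C x * (cos (2 * \<phi> x) * (2 * \<phi>' x)))
        - (k - q)
      = \<phi>' x - (k - q) - \<sigma> x * sin (2 * \<psi> x)
        + 2 * \<phi>' x * (S x * sin (2 * \<phi> x) - C x * cos (2 * \<phi> x))"
      unfolding sin_split by (simp add: algebra_simps)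
    also have "\<dots> = E' x" unfolding E'_def \<phi>'_def by simp
    finally show ?thesis .
  qed
  have E'_bound: "\<bar>E' x\<bar> \<le> M\<^sup>2 / k + 8 * A * D" if x: "x \<in> {0..L}" for x
  proof -
    have "(\<sigma> x)\<^sup>2 / k * (sin (\<psi> x))\<^sup>2 \<le> M\<^sup>2 / k * 1"
      using M(1)[OF x] \<open>k \<ge> 1\<close>
      by (intro mult_mono divide_right_mono) (auto simp: abs_le_square_iff[symmetric] abs_square_le_1)
    moreover have "(\<sigma> x)\<^sup>2 / k * (sin (\<psi> x))\<^sup>2 \<ge> 0" using \<open>k \<ge> 1\<close> by simp
    moreover have "\<bar>2 * \<phi>' x * (S x * sin (2 * \<phi> x) - C x * cos (2 * \<phi> x))\<bar> \<le> (2 * (2 * D)) * (2 * A)"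
      unfolding abs_mult[of "2 * \<phi>' x"]
    proof (intro mult_mono)
      have "\<bar>\<sigma> x * sin (2 * \<psi> x) + (\<sigma> x)\<^sup>2 / k * (sin (\<psi> x))\<^sup>2\<bar> \<le> M + M\<^sup>2"
        by (rule rescaled_prufer_angle_growth(2)[OF \<open>L > 0\<close> \<open>k \<ge> 1\<close> \<psi>0 \<psi>' M x])
      from order_trans[OF abs_triangle_ineq add_mono[OF kq this]]
      have "\<bar>\<phi>' x\<bar> \<le> 2 * D" by (simp only: \<phi>'_def D_def mult_2)
      then show "\<bar>2 * \<phi>' x\<bar> \<le> 2 * (2 * D)" by (simp add: abs_mult)
      have "\<bar>S x * sin (2 * \<phi> x)\<bar> \<le> A * 1"
        unfolding abs_mult using sin_int[OF x] \<open>A \<ge> 0\<close> by (intro mult_mono) (auto simp: S_def)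
      moreover have "\<bar>C x * cos (2 * \<phi> x)\<bar> \<le> A * 1"
        unfolding abs_mult using cos_int[OF x] \<open>A \<ge> 0\<close> by (intro mult_mono) (auto simp: C_def)
      ultimately show "\<bar>S x * sin (2 * \<phi> x) - C x * cos (2 * \<phi> x)\<bar> \<le> 2 * A"
        using abs_triangle_ineq4[of "S x * sin (2 * \<phi> x)" "C x * cos (2 * \<phi> x)"] by linarith
    qed (use \<open>D \<ge> 0\<close> in auto)
    ultimately have "\<bar>E' x\<bar> \<le> M\<^sup>2 / k * 1 + (2 * (2 * D)) * (2 * A)"
      unfolding E'_def
      using abs_triangle_ineq[of "(\<sigma> x)\<^sup>2 / k * (sin (\<psi> x))\<^sup>2"
          "2 * \<phi>' x * (S x * sin (2 * \<phi> x) - C x * cos (2 * \<phi> x))"] by linarith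
    then show ?thesis by (simp add: mult_ac)
  qed
  have "\<bar>E L - E 0\<bar> \<le> (M\<^sup>2 / k + 8 * A * D) * (L - 0)"
    using \<open>L > 0\<close> E_deriv E'_bound by (intro increment_le_within[where f' = E']) auto
  moreover have "E 0 = 0" by (simp add: E_def \<phi>_def S_def C_def \<psi>0)
  moreover have "E L = - S L - (k - q) * L" by (simp add: E_def \<phi>_def \<psi>L)
  moreover have "\<bar>S L\<bar> \<le> A" using sin_int[of L] \<open>L > 0\<close> by (simp add: S_def)
  moreover have "\<bar>(k - q) * L\<bar> \<le> \<bar>- S L\<bar> + \<bar>E L\<bar>"
    using abs_triangle_ineq4[of "- S L" "E L"] by (simp add: \<open>E L = - S L - (k - q) * L\<close>)
  ultimately have "\<bar>(k - q) * L\<bar> \<le> A + (M\<^sup>2 / k + 8 * A * D) * L" by simp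
  then show "\<bar>k - q\<bar> * L \<le> A + (M\<^sup>2 / k + 8 * A * (M + M\<^sup>2)) * L"
    using \<open>L > 0\<close> by (simp add: abs_mult D_def)
qed

section \<open>Dirichlet eigenvalues as zeros of the sine of the endpoint angle\<close>

text \<open>The real classical form of \<open>l\<^sub>\<sigma> y = \<mu> y\<close> as a first-order system in
  \<open>y\<close> and its quasi-derivative.\<close>

definition quasi_solution ::
    "real \<Rightarrow> (real \<Rightarrow> real) \<Rightarrow> real \<Rightarrow> (real \<Rightarrow> real) \<Rightarrow> (real \<Rightarrow> real) \<Rightarrow> bool" where
  "quasi_solution L \<sigma> \<mu> y u \<longleftrightarrow> (\<forall>x\<in>{0..L}.
     (y has_real_derivative u x + \<sigma> x * y x) (at x within {0..L}) \<and>
     (u has_real_derivative - \<sigma> x * u x - ((\<sigma> x)\<^sup>2 + \<mu>) * y x) (at x within {0..L}))"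

lemma quasi_solutionD:
  assumes "quasi_solution L \<sigma> \<mu> y u" "x \<in> {0..L}"
  shows "(y has_real_derivative u x + \<sigma> x * y x) (at x within {0..L})"
    "(u has_real_derivative - \<sigma> x * u x - ((\<sigma> x)\<^sup>2 + \<mu>) * y x) (at x within {0..L})"
  using assms by (auto simp: quasi_solution_def)

lemma quasi_solution_linear_combination:
  assumes "quasi_solution L \<sigma> \<mu> y u" "quasi_solution L \<sigma> \<mu> z v"
  shows "quasi_solution L \<sigma> \<mu> (\<lambda>x. z x - c * y x) (\<lambda>x. v x - c * u x)"
  unfolding quasi_solution_def
proof (intro ballI conjI)
  fix x assume x: "x \<in> {0..L}"
  note d = quasi_solutionD[OF assms(1) x] quasi_solutionD[OF assms(2) x]
  show "((\<lambda>x. z x - c * y x) has_real_derivative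
      (v x - c * u x) + \<sigma> x * (z x - c * y x)) (at x within {0..L})"
    using DERIV_diff[OF d(3) DERIV_cmult[OF d(1), of c]] by (simp add: algebra_simps)
  show "((\<lambda>x. v x - c * u x) has_real_derivative
      - \<sigma> x * (v x - c * u x) - ((\<sigma> x)\<^sup>2 + \<mu>) * (z x - c * y x)) (at x within {0..L})"
    using DERIV_diff[OF d(4) DERIV_cmult[OF d(2), of c]] by (simp add: algebra_simps)
qed

text \<open>Uniqueness for the initial value problem: \<open>z\<^sup>2 + v\<^sup>2\<close> is bounded in growth
  by a multiple of itself, which is the differential inequality above for its negative.\<close>

lemma quasi_solution_zero:
  assumes sol: "quasi_solution L \<sigma> \<mu> z v" and "z 0 = 0" "v 0 = 0"
    and cont: "continuous_on {0..L} \<sigma>" and x: "x \<in> {0..L}"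
  shows "z x = 0"
proof -
  obtain M where M: "M \<ge> 0" "\<And>x. x \<in> {0..L} \<Longrightarrow> \<bar>\<sigma> x\<bar> \<le> M"
    using continuous_bounded[OF cont] by blast
  define K where "K = 1 + 2 * M + (M\<^sup>2 + \<bar>\<mu>\<bar>)"
  \<comment> \<open>The negative, so that nonnegativity of \<open>E\<close> forces both components to vanish.\<close>
  define E where "E x = - ((z x)\<^sup>2 + (v x)\<^sup>2)" for x
  define E' where "E' x = - (2 * \<sigma> x * ((z x)\<^sup>2 - (v x)\<^sup>2) + (1 - (\<sigma> x)\<^sup>2 - \<mu>) * (2 * z x * v x))" for x
  have "E x \<ge> 0"
  proof (rule differential_inequality_nonneg[where D = E and D' = E' and K = K])
    show "E 0 = 0" using assms by (simp add: E_def)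
    fix x assume x: "x \<in> {0..L}"
    note d = quasi_solutionD[OF sol x]
    show "(E has_real_derivative E' x) (at x within {0..L})"
      unfolding E_def E'_def
      by (rule derivative_eq_intros d refl)+ (simp add: algebra_simps power2_eq_square)
    have "\<bar>E' x\<bar> \<le> \<bar>2 * \<sigma> x * ((z x)\<^sup>2 - (v x)\<^sup>2)\<bar> + \<bar>(1 - (\<sigma> x)\<^sup>2 - \<mu>) * (2 * z x * v x)\<bar>"
      unfolding E'_def abs_minus_cancel by (rule abs_triangle_ineq)
    also have "\<dots> \<le> (2 * M) * ((z x)\<^sup>2 + (v x)\<^sup>2) + (1 + (M\<^sup>2 + \<bar>\<mu>\<bar>)) * ((z x)\<^sup>2 + (v x)\<^sup>2)"
    proof (intro add_mono)
      show "\<bar>2 * \<sigma> x * ((z x)\<^sup>2 - (v x)\<^sup>2)\<bar> \<le> (2 * M) * ((z x)\<^sup>2 + (v x)\<^sup>2)"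
        unfolding abs_mult using M(2)[OF x] M(1) by (intro mult_mono) (auto simp: abs_le_iff)
      have sq: "(\<sigma> x)\<^sup>2 \<le> M\<^sup>2" using M(2)[OF x] by (simp add: abs_le_square_iff[symmetric])
      show "\<bar>(1 - (\<sigma> x)\<^sup>2 - \<mu>) * (2 * z x * v x)\<bar> \<le> (1 + (M\<^sup>2 + \<bar>\<mu>\<bar>)) * ((z x)\<^sup>2 + (v x)\<^sup>2)"
        unfolding abs_mult[of "1 - (\<sigma> x)\<^sup>2 - \<mu>"]
      proof (intro mult_mono)
        have "\<bar>1 - s - \<mu>\<bar> \<le> 1 + (m + \<bar>\<mu>\<bar>)" if "0 \<le> s" "s \<le> m" for s m
          using that by (auto simp: abs_if)
        then show "\<bar>1 - (\<sigma> x)\<^sup>2 - \<mu>\<bar> \<le> 1 + (M\<^sup>2 + \<bar>\<mu>\<bar>)"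
          using sq by simp
        have "0 \<le> (z x - v x)\<^sup>2" "0 \<le> (z x + v x)\<^sup>2" by simp_all
        then show "\<bar>2 * z x * v x\<bar> \<le> (z x)\<^sup>2 + (v x)\<^sup>2"
          by (intro abs_leI) (simp_all add: power2_sum power2_diff)
      qed auto
    qed
    also have "\<dots> = K * \<bar>E x\<bar>"
      by (simp add: E_def K_def abs_of_nonneg algebra_simps)
    finally show "E' x \<ge> - (K * \<bar>E x\<bar>)" by (simp add: abs_le_iff)
  qed (rule x)
  then have "(z x)\<^sup>2 + (v x)\<^sup>2 \<le> 0" by (simp add: E_def)
  then show ?thesis using sum_power2_le_zero_iff by blast
qed

text \<open>The modulus is recovered from the angle: \<open>r' / r = \<rho>\<close> involves
  \<open>\<theta>\<close> but not \<open>r\<close>, so \<open>r\<close> is an explicit exponential.\<close>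

lemma quasi_solution_of_prufer_angle:
  assumes \<theta>: "prufer_angle L \<sigma> \<mu> \<theta>" and cont: "continuous_on {0..L} \<sigma>"
  obtains r where "\<And>x. r x > 0" "r 0 = 1"
    "quasi_solution L \<sigma> \<mu> (\<lambda>x. r x * sin (\<theta> x)) (\<lambda>x. r x * cos (\<theta> x))"
proof -
  define \<rho> where "\<rho> x = (1 - \<mu> - (\<sigma> x)\<^sup>2) * sin (\<theta> x) * cos (\<theta> x)
      + \<sigma> x * ((sin (\<theta> x))\<^sup>2 - (cos (\<theta> x))\<^sup>2)" for x
  define r where "r x = exp (integral {0..x} \<rho>)" for x
  have cont_\<rho>: "continuous_on {0..L} \<rho>"
    unfolding \<rho>_def by (intro continuous_intros cont prufer_angleD(3)[OF \<theta>])
  have r': "(r has_real_derivative r x * \<rho> x) (at x within {0..L})" if "x \<in> {0..L}" for x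
    unfolding r_def
    using DERIV_chain2[OF DERIV_exp integral_has_real_derivative[OF cont_\<rho> that]] .
  show ?thesis
  proof (rule that[of r])
    show "r x > 0" for x by (simp add: r_def)
    show "r 0 = 1" by (simp add: r_def)
    show "quasi_solution L \<sigma> \<mu> (\<lambda>x. r x * sin (\<theta> x)) (\<lambda>x. r x * cos (\<theta> x))"
      unfolding quasi_solution_def
    proof (intro ballI conjI)
      fix x assume x: "x \<in> {0..L}"
      define s c where "s = sin (\<theta> x)" and "c = cos (\<theta> x)"
      have sc: "s\<^sup>2 = 1 - c\<^sup>2" by (simp add: s_def c_def sin_squared_eq)
      note d = r'[OF x] prufer_angleD(2)[OF \<theta> x]
      show "((\<lambda>x. r x * sin (\<theta> x)) has_real_derivative
          r x * cos (\<theta> x) + \<sigma> x * (r x * sin (\<theta> x))) (at x within {0..L})"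
      proof (rule DERIV_cong[OF DERIV_mult[OF d(1) DERIV_chain2[OF DERIV_sin d(2)]]])
        have "\<rho> x * s + c * prufer_rhs \<sigma> \<mu> x (\<theta> x) = c + \<sigma> x * s"
          using sc unfolding \<rho>_def prufer_rhs_def s_def[symmetric] c_def[symmetric] by algebra
        then show "r x * \<rho> x * sin (\<theta> x) + cos (\<theta> x) * prufer_rhs \<sigma> \<mu> x (\<theta> x) * r x
            = r x * cos (\<theta> x) + \<sigma> x * (r x * sin (\<theta> x))"
          unfolding s_def c_def by algebra
      qed
      show "((\<lambda>x. r x * cos (\<theta> x)) has_real_derivative
          - \<sigma> x * (r x * cos (\<theta> x)) - ((\<sigma> x)\<^sup>2 + \<mu>) * (r x * sin (\<theta> x))) (at x within {0..L})"
      proof (rule DERIV_cong[OF DERIV_mult[OF d(1) DERIV_chain2[OF DERIV_cos d(2)]]])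
        have "\<rho> x * c - s * prufer_rhs \<sigma> \<mu> x (\<theta> x) = - \<sigma> x * c - ((\<sigma> x)\<^sup>2 + \<mu>) * s"
          using sc unfolding \<rho>_def prufer_rhs_def s_def[symmetric] c_def[symmetric] by algebra
        then show "r x * \<rho> x * cos (\<theta> x) + - sin (\<theta> x) * prufer_rhs \<sigma> \<mu> x (\<theta> x) * r x
            = - \<sigma> x * (r x * cos (\<theta> x)) - ((\<sigma> x)\<^sup>2 + \<mu>) * (r x * sin (\<theta> x))"
          unfolding s_def c_def by algebra
      qed
    qed
  qed
qed

text \<open>By uniqueness every solution vanishing at \<open>0\<close> is a multiple of the polar one, which
  does not vanish at \<open>L\<close> when \<open>sin (\<theta> L) \<noteq> 0\<close>.\<close>

lemma quasi_solution_dirichlet_trivial: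
  assumes "L > 0" and \<theta>: "prufer_angle L \<sigma> \<mu> \<theta>" and cont: "continuous_on {0..L} \<sigma>"
    and sol: "quasi_solution L \<sigma> \<mu> z v" and "z 0 = 0" "z L = 0" and "sin (\<theta> L) \<noteq> 0"
    and x: "x \<in> {0..L}"
  shows "z x = 0"
proof -
  obtain r where r: "\<And>x. r x > 0" "r 0 = 1"
    "quasi_solution L \<sigma> \<mu> (\<lambda>x. r x * sin (\<theta> x)) (\<lambda>x. r x * cos (\<theta> x))"
    by (rule quasi_solution_of_prufer_angle[OF \<theta> cont]) (rule that)
  have eq: "z x - v 0 * (r x * sin (\<theta> x)) = 0" if "x \<in> {0..L}" for x
    by (rule quasi_solution_zero[OF quasi_solution_linear_combination[OF r(3) sol] _ _ cont that])
      (use r(2) prufer_angleD(1)[OF \<theta>] \<open>z 0 = 0\<close> in auto)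
  have "v 0 = 0" using eq[of L] \<open>L > 0\<close> \<open>z L = 0\<close> \<open>sin (\<theta> L) \<noteq> 0\<close> r(1)[of L] by simp
  then show ?thesis using eq[OF x] by simp
qed

lemma square_integrable_on_continuous:
  assumes "continuous_on {0..L} f"
  shows "square_integrable_on L f"
proof -
  have m: "f \<in> borel_measurable (lebesgue_on {0<..<L})"
    by (intro continuous_imp_measurable_on_sets_lebesgue continuous_on_subset[OF assms]) auto
  have "continuous_on {0..L} (\<lambda>x. (norm (f x))\<^sup>2)"
    by (intro continuous_intros assms)
  then have "integrable (lebesgue_on {0..L}) (\<lambda>x. (norm (f x))\<^sup>2)"
    using continuous_imp_integrable_real by blast
  then have "set_integrable lebesgue {0..L} (\<lambda>x. (norm (f x))\<^sup>2)"
    unfolding set_integrable_def by (subst (asm) integrable_restrict_space) auto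
  then have "set_integrable lebesgue {0<..<L} (\<lambda>x. (norm (f x))\<^sup>2)"
    by (rule set_integrable_subset) auto
  then have "integrable (lebesgue_on {0<..<L}) (\<lambda>x. (norm (f x))\<^sup>2)"
    unfolding set_integrable_def by (subst integrable_restrict_space) auto
  with m show ?thesis by (simp add: square_integrable_on_def)
qed

lemma absolutely_continuous_on_of_real_C1:
  fixes f f' :: "real \<Rightarrow> real"
  assumes deriv: "\<And>x. x \<in> {0..L} \<Longrightarrow> (f has_real_derivative f' x) (at x within {0..L})"
    and cont: "continuous_on {0..L} f'"
  shows "absolutely_continuous_on 0 L (\<lambda>x. of_real (f x))"
proof -
  obtain K where K: "K \<ge> 0" "\<And>x. x \<in> {0..L} \<Longrightarrow> \<bar>f' x\<bar> \<le> K"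
    using continuous_bounded[OF cont] by blast
  show ?thesis
  proof (rule lipschitz_imp_absolutely_continuous_on)
    fix u v :: real assume uv: "0 \<le> u" "u \<le> v" "v \<le> L"
    have "\<bar>f v - f u\<bar> \<le> K * (v - u)"
      using uv by (intro increment_le_within[where f' = f'] DERIV_subset[OF deriv] K) auto
    then show "norm (of_real (f v) - of_real (f u) :: complex) \<le> K * (v - u)"
      by (simp flip: of_real_diff)
  qed
qed

lemma has_vector_derivative_of_real_interior:
  assumes "(f has_real_derivative d) (at x within {0..L})" "x \<in> {0<..<L}"
  shows "((\<lambda>x. of_real (f x)) has_vector_derivative (of_real d :: complex)) (at x)"
proof -
  have "at x within {0..L} = at x" using assms(2) by (intro at_within_Icc_at) auto
  then have "(f has_vector_derivative d) (at x)"
    using assms(1) by (simp add: has_real_derivative_iff_has_vector_derivative)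
  then show ?thesis by (rule bounded_linear.has_vector_derivative[OF bounded_linear_of_real])
qed

lemma continuous_zero_AE_imp_zero:
  fixes y :: "real \<Rightarrow> 'b :: real_normed_vector"
  assumes "continuous_on {0..L} y" and ae: "AE x in lebesgue_on {0<..<L}. y x = 0"
    and x: "x \<in> {0<..<L}"
  shows "y x = 0"
proof (rule ccontr)
  assume nz: "y x \<noteq> 0"
  have "open {t \<in> {0<..<L}. y t \<noteq> 0}"
  proof -
    have "open ({0<..<L} \<inter> y -` (- {0}))"
      by (intro continuous_open_preimage continuous_on_subset[OF assms(1)]) auto
    moreover have "{0<..<L} \<inter> y -` (- {0}) = {t \<in> {0<..<L}. y t \<noteq> 0}" by auto
    ultimately show ?thesis by simp
  qed
  moreover have "negligible {t \<in> {0<..<L}. y t \<noteq> 0}"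
  proof -
    have "AE t in lebesgue. t \<in> {0<..<L} \<longrightarrow> y t = 0"
      using ae by (subst (asm) AE_restrict_space_iff) auto
    then obtain N where "N \<in> null_sets lebesgue"
      "{t \<in> space lebesgue. \<not> (t \<in> {0<..<L} \<longrightarrow> y t = 0)} \<subseteq> N"
      unfolding eventually_ae_filter by blast
    then have "negligible N" "{t \<in> {0<..<L}. y t \<noteq> 0} \<subseteq> N"
      by (auto simp: negligible_iff_null_sets)
    then show ?thesis by (rule negligible_subset)
  qed
  ultimately have "{t \<in> {0<..<L}. y t \<noteq> 0} = {}"
    using open_not_negligible by blast
  then show False using nz x by auto
qed

text \<open>For an eigenfunction, the real and the imaginary part are real solutions with both boundary values
  \<open>0\<close>, so both vanish unless \<open>sin (\<theta> L) = 0\<close>. Conversely the polar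
  solution is continuously differentiable, hence in the domain, and not zero almost everywhere
  because its derivative at \<open>0\<close> is \<open>1\<close>.\<close>

lemma dirichlet_eigenvalue_iff:
  assumes "L > 0" and cont: "continuous_on {0..L} \<sigma>" and \<theta>: "prufer_angle L \<sigma> \<mu> \<theta>"
  shows "\<mu> \<in> dirichlet_eigenvalues L \<sigma> \<longleftrightarrow> sin (\<theta> L) = 0"
proof
  assume "\<mu> \<in> dirichlet_eigenvalues L \<sigma>"
  then obtain y f where yf: "(y, f) \<in> dirichlet_operator L \<sigma>"
    and nonzero: "\<not> (AE x in lebesgue_on {0<..<L}. y x = 0)"
    and eig: "AE x in lebesgue_on {0<..<L}. f x = of_real \<mu> * y x"
    unfolding dirichlet_eigenvalues_def by auto
  obtain u where ac_y: "absolutely_continuous_on 0 L y" and ac_u: "absolutely_continuous_on 0 L u"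
    and y': "AE x in lebesgue_on {0<..<L}. (y has_vector_derivative (u x + of_real (\<sigma> x) * y x)) (at x)"
    and quasi: "is_quasi_expression L \<sigma> y u f" and bc: "y 0 = 0" "y L = 0"
    using yf unfolding dirichlet_operator_def has_ac_quasi_derivative_def by auto
  note cont_y = absolutely_continuous_on_imp_continuous_on[OF ac_y]
    and cont_u = absolutely_continuous_on_imp_continuous_on[OF ac_u]
  have u': "AE x in lebesgue_on {0<..<L}. (u has_vector_derivative
      (- of_real (\<sigma> x) * u x - of_real ((\<sigma> x)\<^sup>2 + \<mu>) * y x)) (at x)"
    using quasi[unfolded is_quasi_expression_def] eig
  proof eventually_elim
    case (elim x)
    then obtain u' where u': "(u has_vector_derivative u') (at x)"
      and eq: "of_real \<mu> * y x = - u' - of_real (\<sigma> x) * u x - (of_real (\<sigma> x))\<^sup>2 * y x" by auto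
    have "u' = - of_real (\<sigma> x) * u x - (of_real (\<sigma> x))\<^sup>2 * y x - of_real \<mu> * y x"
      by (simp add: eq)
    also have "\<dots> = - of_real (\<sigma> x) * u x - of_real ((\<sigma> x)\<^sup>2 + \<mu>) * y x"
      by (simp add: distrib_right)
    finally show ?case using u' by simp
  qed
  have dy: "(y has_vector_derivative (u x + of_real (\<sigma> x) * y x)) (at x within {0..L})"
    if "x \<in> {0..L}" for x
    by (rule absolutely_continuous_on_has_derivative[OF \<open>L > 0\<close> ac_y _ y' that])
      (intro continuous_intros cont cont_y cont_u)
  have du: "(u has_vector_derivative
      (- of_real (\<sigma> x) * u x - of_real ((\<sigma> x)\<^sup>2 + \<mu>) * y x)) (at x within {0..L})"
    if "x \<in> {0..L}" for x
    by (rule absolutely_continuous_on_has_derivative[OF \<open>L > 0\<close> ac_u _ u' that])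
      (intro continuous_intros cont cont_y cont_u)
  have Re: "quasi_solution L \<sigma> \<mu> (\<lambda>x. Re (y x)) (\<lambda>x. Re (u x))"
    unfolding quasi_solution_def has_real_derivative_iff_has_vector_derivative
    using bounded_linear.has_vector_derivative[OF bounded_linear_Re dy]
      bounded_linear.has_vector_derivative[OF bounded_linear_Re du] by simp
  have Im: "quasi_solution L \<sigma> \<mu> (\<lambda>x. Im (y x)) (\<lambda>x. Im (u x))"
    unfolding quasi_solution_def has_real_derivative_iff_has_vector_derivative
    using bounded_linear.has_vector_derivative[OF bounded_linear_Im dy]
      bounded_linear.has_vector_derivative[OF bounded_linear_Im du] by simp
  show "sin (\<theta> L) = 0"
  proof (rule ccontr)
    assume nz: "sin (\<theta> L) \<noteq> 0"
    have "y x = 0" if "x \<in> {0..L}" for x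
      using quasi_solution_dirichlet_trivial[OF \<open>L > 0\<close> \<theta> cont Re _ _ nz that]
        quasi_solution_dirichlet_trivial[OF \<open>L > 0\<close> \<theta> cont Im _ _ nz that] bc
      by (simp add: complex_eq_iff)
    then have "AE x in lebesgue_on {0<..<L}. y x = 0"
      by (intro AE_I2) (simp add: space_restrict_space)
    then show False using nonzero by simp
  qed
next
  assume zero: "sin (\<theta> L) = 0"
  obtain r where r: "\<And>x. r x > 0" "r 0 = 1"
    "quasi_solution L \<sigma> \<mu> (\<lambda>x. r x * sin (\<theta> x)) (\<lambda>x. r x * cos (\<theta> x))"
    by (rule quasi_solution_of_prufer_angle[OF \<theta> cont]) (rule that)
  define y u where "y x = r x * sin (\<theta> x)" and "u x = r x * cos (\<theta> x)" for x
  have sol: "quasi_solution L \<sigma> \<mu> y u" using r(3) by (simp add: y_def[abs_def] u_def[abs_def])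
  note d = quasi_solutionD[OF sol]
  have cont_y: "continuous_on {0..L} y" and cont_u: "continuous_on {0..L} u"
    using DERIV_continuous_on[OF d(1)] DERIV_continuous_on[OF d(2)] by blast+
  define Y U F :: "real \<Rightarrow> complex"
    where "Y x = of_real (y x)" and "U x = of_real (u x)" and "F x = of_real (\<mu> * y x)" for x
  have "absolutely_continuous_on 0 L Y"
    unfolding Y_def by (rule absolutely_continuous_on_of_real_C1[OF d(1)])
      (auto intro!: continuous_intros cont cont_y cont_u)
  moreover have "absolutely_continuous_on 0 L U"
    unfolding U_def by (rule absolutely_continuous_on_of_real_C1[OF d(2)])
      (auto intro!: continuous_intros cont cont_y cont_u)
  moreover have "AE x in lebesgue_on {0<..<L}. (Y has_vector_derivative (U x + of_real (\<sigma> x) * Y x)) (at x)"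
  proof (rule AE_I2)
    fix x assume "x \<in> space (lebesgue_on {0<..<L})"
    then have x: "x \<in> {0<..<L}" by (simp add: space_restrict_space)
    show "(Y has_vector_derivative (U x + of_real (\<sigma> x) * Y x)) (at x)"
      using has_vector_derivative_of_real_interior[OF d(1) x] x by (simp add: Y_def[abs_def] U_def)
  qed
  moreover have "is_quasi_expression L \<sigma> Y U F"
    unfolding is_quasi_expression_def
  proof (rule AE_I2)
    fix x assume "x \<in> space (lebesgue_on {0<..<L})"
    then have x: "x \<in> {0<..<L}" by (simp add: space_restrict_space)
    define u' where "u' = - \<sigma> x * u x - ((\<sigma> x)\<^sup>2 + \<mu>) * y x"
    have "(U has_vector_derivative of_real u') (at x)"
      using has_vector_derivative_of_real_interior[OF d(2) x] x by (simp add: U_def[abs_def] u'_def)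
    moreover have "F x = - of_real u' - of_real (\<sigma> x) * U x - (of_real (\<sigma> x))\<^sup>2 * Y x"
      by (simp add: F_def U_def Y_def u'_def algebra_simps)
    ultimately show "\<exists>u'. (U has_vector_derivative u') (at x) \<and>
        F x = - u' - of_real (\<sigma> x) * U x - (of_real (\<sigma> x))\<^sup>2 * Y x" by blast
  qed
  moreover have "square_integrable_on L Y" "square_integrable_on L F"
    unfolding Y_def F_def
    by (auto intro!: square_integrable_on_continuous continuous_intros cont_y)
  moreover have "Y 0 = 0" "Y L = 0"
    using prufer_angleD(1)[OF \<theta>] zero by (simp_all add: Y_def y_def)
  ultimately have "(Y, F) \<in> dirichlet_operator L \<sigma>"
    unfolding dirichlet_operator_def has_ac_quasi_derivative_def by auto
  moreover have "\<not> (AE x in lebesgue_on {0<..<L}. Y x = 0)"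
  proof
    assume "AE x in lebesgue_on {0<..<L}. Y x = 0"
    moreover have "continuous_on {0..L} Y" unfolding Y_def by (intro continuous_intros cont_y)
    ultimately have "Y x = 0" if "x \<in> {0<..<L}" for x
      using that by (intro continuous_zero_AE_imp_zero[of L Y])
    then have y0: "y x = 0" if "x \<in> {0..L}" for x
      using that prufer_angleD(1)[OF \<theta>] zero by (cases "x = 0 \<or> x = L") (auto simp: Y_def y_def)
    have "(y has_real_derivative u 0 + \<sigma> 0 * y 0) (at 0 within {0..L})"
      using \<open>L > 0\<close> by (intro d) auto
    moreover have "u 0 + \<sigma> 0 * y 0 = 1"
      by (simp add: u_def y_def r(2) prufer_angleD(1)[OF \<theta>])
    ultimately have "(y has_real_derivative 1) (at 0 within {0..L})" by simp
    then obtain e where e: "e > 0" "\<And>h. 0 < h \<Longrightarrow> 0 + h \<in> {0..L} \<Longrightarrow> h < e \<Longrightarrow> y 0 < y (0 + h)"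
      using has_real_derivative_pos_inc_right[of y 1 0 "{0..L}"] by auto
    have "y 0 < y (0 + min L (e / 2))" using \<open>L > 0\<close> e(1) by (intro e(2)) auto
    then show False using y0[of 0] y0[of "min L (e / 2)"] \<open>L > 0\<close> e(1) by simp
  qed
  moreover have "AE x in lebesgue_on {0<..<L}. F x = of_real \<mu> * Y x"
    by (simp add: F_def Y_def)
  ultimately show "\<mu> \<in> dirichlet_eigenvalues L \<sigma>"
    unfolding dirichlet_eigenvalues_def by blast
qed

text \<open>Since \<open>w > 0\<close>, only the levels \<open>n \<pi>\<close> with \<open>n \<ge> 1\<close> can
  be attained, and by the intermediate value theorem and monotonicity each of them is attained
  exactly once.\<close>

lemma enumeration_of_sine_zeros:
  fixes w :: "real \<Rightarrow> real"
  assumes mono: "strict_mono w" and cont: "\<And>\<mu>. isCont w \<mu>" and pos: "\<And>\<mu>. w \<mu> > 0"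
    and low: "w a < pi" and high: "\<And>T. \<exists>\<mu>. w \<mu> > T"
  obtains l where "strict_mono_on {1..} l" "{\<mu>. sin (w \<mu>) = 0} = l ` {1..}"
    "\<And>n::nat. n \<ge> 1 \<Longrightarrow> w (l n) = real n * pi"
proof -
  have "\<exists>\<mu>. n \<ge> 1 \<longrightarrow> w \<mu> = real n * pi" for n :: nat
  proof (cases "n \<ge> 1")
    case True
    obtain b where b: "w b > real n * pi" using high by blast
    have "pi \<le> real n * pi" using True by simp
    then have "w a < w b" "w a \<le> real n * pi" using low b by linarith+
    then have "a \<le> b" using mono by (simp add: strict_mono_less)
    then show ?thesis
      using IVT[of w a "real n * pi" b] cont b \<open>w a \<le> real n * pi\<close> by auto
  qed auto
  then obtain l where l: "\<And>n::nat. n \<ge> 1 \<Longrightarrow> w (l n) = real n * pi" by metis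
  show ?thesis
  proof (rule that[of l])
    show "strict_mono_on {1..} l"
    proof (rule strict_mono_onI)
      fix m n :: nat assume mn: "m \<in> {1..}" "n \<in> {1..}" "m < n"
      then have "w (l m) < w (l n)" by (simp add: l)
      then show "l m < l n" using mono by (simp add: strict_mono_less)
    qed
    show "{\<mu>. sin (w \<mu>) = 0} = l ` {1..}"
    proof (intro equalityI subsetI)
      fix \<mu> assume "\<mu> \<in> {\<mu>. sin (w \<mu>) = 0}"
      then obtain i :: int where i: "w \<mu> = of_int i * pi" by (auto simp: sin_zero_iff_int2)
      have "i \<ge> 1" using pos[of \<mu>] unfolding i by (simp add: zero_less_mult_iff)
      then have "w \<mu> = real (nat i) * pi" "nat i \<ge> 1" by (simp_all add: i)
      then have "w (l (nat i)) = w \<mu>" by (simp add: l)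
      then have "\<mu> = l (nat i)" using mono by (simp add: strict_mono_eq)
      then show "\<mu> \<in> l ` {1..}" using \<open>nat i \<ge> 1\<close> by auto
    next
      fix \<mu> assume "\<mu> \<in> l ` {1..}"
      then show "\<mu> \<in> {\<mu>. sin (w \<mu>) = 0}" by (auto simp: l)
    qed
  qed (rule l)
qed

section \<open>Exponential moments of oscillatory integrals of Brownian motion\<close>

text \<open>Completing the square turns \<open>exp (a z)\<close> times the centred density into a multiple of
  the density with mean \<open>a \<tau>\<^sup>2\<close>.\<close>

lemma nn_integral_exp_normal:
  assumes X: "distributed M lborel X (\<lambda>z. ennreal (normal_density 0 \<tau> z))" and "\<tau> > 0"
  shows "(\<integral>\<^sup>+\<omega>. ennreal (exp (a * X \<omega>)) \<partial>M) = ennreal (exp (a\<^sup>2 * \<tau>\<^sup>2 / 2))"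
proof -
  have shift: "normal_density 0 \<tau> z * exp (a * z)
      = exp (a\<^sup>2 * \<tau>\<^sup>2 / 2) * normal_density (a * \<tau>\<^sup>2) \<tau> z" for z
  proof -
    have "- (z - 0)\<^sup>2 / (2 * \<tau>\<^sup>2) + a * z = a\<^sup>2 * \<tau>\<^sup>2 / 2 + (- (z - a * \<tau>\<^sup>2)\<^sup>2 / (2 * \<tau>\<^sup>2))"
      using \<open>\<tau> > 0\<close> by (simp add: field_simps power2_eq_square)
    then have "exp (- (z - 0)\<^sup>2 / (2 * \<tau>\<^sup>2)) * exp (a * z)
        = exp (a\<^sup>2 * \<tau>\<^sup>2 / 2) * exp (- (z - a * \<tau>\<^sup>2)\<^sup>2 / (2 * \<tau>\<^sup>2))"
      by (simp only: flip: exp_add)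
    then show ?thesis unfolding normal_density_def by (simp add: mult.assoc mult.left_commute)
  qed
  have "(\<integral>\<^sup>+\<omega>. ennreal (exp (a * X \<omega>)) \<partial>M)
      = (\<integral>\<^sup>+z. ennreal (normal_density 0 \<tau> z) * ennreal (exp (a * z)) \<partial>lborel)"
    by (rule distributed_nn_integral[OF X, symmetric]) simp
  also have "\<dots> = (\<integral>\<^sup>+z. ennreal (exp (a\<^sup>2 * \<tau>\<^sup>2 / 2)) * ennreal (normal_density (a * \<tau>\<^sup>2) \<tau> z) \<partial>lborel)"
    by (simp add: shift flip: ennreal_mult)
  also have "\<dots> = ennreal (exp (a\<^sup>2 * \<tau>\<^sup>2 / 2)) * (\<integral>\<^sup>+z. ennreal (normal_density (a * \<tau>\<^sup>2) \<tau> z) \<partial>lborel)"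
    by (rule nn_integral_cmult) simp
  also have "(\<integral>\<^sup>+z. ennreal (normal_density (a * \<tau>\<^sup>2) \<tau> z) \<partial>lborel) = 1"
    using \<open>\<tau> > 0\<close> by (subst nn_integral_eq_integral) auto
  finally show ?thesis by simp
qed

lemma brownian_increments_exp_moment:
  assumes bm: "standard_brownian_motion_on M L B"
    and t: "\<And>i. i \<le> m \<Longrightarrow> t i \<in> {0..L}" "\<And>i. i < m \<Longrightarrow> t i < t (Suc i)"
  shows "(\<integral>\<^sup>+\<omega>. ennreal (exp (\<Sum>i<m. c i * (B (t (Suc i)) \<omega> - B (t i) \<omega>))) \<partial>M)
      = ennreal (exp (\<Sum>i<m. (c i)\<^sup>2 * (t (Suc i) - t i) / 2))"
proof -
  interpret prob_space M using bm by (simp add: standard_brownian_motion_on_def)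
  define X where "X i \<omega> = B (t (Suc i)) \<omega> - B (t i) \<omega>" for i \<omega>
  have normal: "distributed M lborel (X i) (\<lambda>z. ennreal (normal_density 0 (sqrt (t (Suc i) - t i)) z))"
    if "i < m" for i
    using bm t(1)[of i] t(1)[of "Suc i"] t(2)[of i] that
    unfolding standard_brownian_motion_on_def X_def[abs_def] by auto
  have "indep_vars (\<lambda>_. borel) (\<lambda>i \<omega>. X i \<omega>) {..<m}"
    using bm t less_imp_le[OF t(2)] unfolding standard_brownian_motion_on_def X_def by auto
  then have "indep_vars (\<lambda>_. borel) (\<lambda>i \<omega>. ennreal (exp (c i * X i \<omega>))) {..<m}"
    by (rule indep_vars_compose2) auto
  then have "(\<integral>\<^sup>+\<omega>. (\<Prod>i<m. ennreal (exp (c i * X i \<omega>))) \<partial>M)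
      = (\<Prod>i<m. \<integral>\<^sup>+\<omega>. ennreal (exp (c i * X i \<omega>)) \<partial>M)"
    by (intro indep_vars_nn_integral) auto
  also have "\<dots> = (\<Prod>i<m. ennreal (exp ((c i)\<^sup>2 * (t (Suc i) - t i) / 2)))"
  proof (rule prod.cong)
    fix i assume "i \<in> {..<m}"
    then have "i < m" by simp
    then show "(\<integral>\<^sup>+\<omega>. ennreal (exp (c i * X i \<omega>)) \<partial>M)
        = ennreal (exp ((c i)\<^sup>2 * (t (Suc i) - t i) / 2))"
      using nn_integral_exp_normal[OF normal, of i "c i"] t(2)[of i] by simp
  qed simp
  finally show ?thesis by (simp add: X_def exp_sum prod_ennreal)
qed

lemma summation_by_parts:
  fixes b g :: "nat \<Rightarrow> real"
  shows "(\<Sum>i<m. b i * (g (Suc i) - g i))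
    = (\<Sum>i<m. (g m - g (Suc i)) * (b (Suc i) - b i)) + b 0 * (g m - g 0)"
proof -
  define P where "P = (\<Sum>i<m. g (Suc i) * (b (Suc i) - b i))"
  have "(\<Sum>i<m. b i * (g (Suc i) - g i)) = b m * g m - b 0 * g 0 - P"
    unfolding P_def by (induction m) (simp_all add: algebra_simps)
  moreover have "(\<Sum>i<m. g m * (b (Suc i) - b i)) = g m * (b m - b 0)"
    by (simp add: sum_lessThan_telescope flip: sum_distrib_left)
  then have "(\<Sum>i<m. (g m - g (Suc i)) * (b (Suc i) - b i)) = g m * (b m - b 0) - P"
    by (simp only: left_diff_distrib sum_subtractf P_def)
  ultimately show ?thesis by (simp only: algebra_simps)
qed

text \<open>Sums over exact increments of the primitive \<open>G\<close>, instead of \<open>g (t i)\<close>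
  times the mesh width: after summation by parts the coefficients are differences of values of
  \<open>G\<close>, whose bound does not depend on the mesh. The number of intervals is
  \<open>Suc m\<close> to avoid a division by zero.\<close>

lemma riemann_stieltjes_sums_converge:
  fixes f g G :: "real \<Rightarrow> real"
  assumes "x > 0" and f: "continuous_on {0..x} f" and g: "continuous_on {0..x} g"
    and G: "\<And>s. (G has_real_derivative g s) (at s)" and g_le: "\<And>s. \<bar>g s\<bar> \<le> 1"
  defines "t \<equiv> \<lambda>m i. real i * x / real (Suc m)"
  shows "(\<lambda>m. \<Sum>i<Suc m. f (t m i) * (G (t m (Suc i)) - G (t m i)))
    \<longlonglongrightarrow> integral {0..x} (\<lambda>s. f s * g s)"
proof (rule LIMSEQ_I)
  fix r :: real assume "r > 0"
  define e where "e = r / (2 * x)"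
  have "e > 0" using \<open>r > 0\<close> \<open>x > 0\<close> by (simp add: e_def)
  have "uniformly_continuous_on {0..x} f"
    by (intro compact_uniformly_continuous f) auto
  then obtain d where d: "d > 0" "\<And>u v. u \<in> {0..x} \<Longrightarrow> v \<in> {0..x} \<Longrightarrow> \<bar>v - u\<bar> < d \<Longrightarrow> \<bar>f v - f u\<bar> < e"
    using \<open>e > 0\<close> unfolding uniformly_continuous_on_def dist_real_def by metis
  obtain N :: nat where N: "N > x / d" using reals_Archimedean2 by blast
  have "\<bar>(\<Sum>i<Suc m. f (t m i) * (G (t m (Suc i)) - G (t m i))) - integral {0..x} (\<lambda>s. f s * g s)\<bar> < r"
    if "m \<ge> N" for m
  proof -
    define H where "H y = integral {0..y} (\<lambda>s. f s * g s)" for y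
    have H': "(H has_real_derivative f y * g y) (at y within {0..x})" if "y \<in> {0..x}" for y
      unfolding H_def by (intro integral_has_real_derivative continuous_intros f g that)
    have "real (Suc m) > x / d" using N that by linarith
    then have mesh: "x / real (Suc m) < d" using d(1) by (simp add: field_simps)
    have step: "t m (Suc i) = t m i + x / real (Suc m)" for i
      by (simp add: t_def add_divide_distrib distrib_right)
    have step_pos: "x / real (Suc m) > 0" using \<open>x > 0\<close> by simp
    have t_range: "t m i \<in> {0..x}" if "i \<le> Suc m" for i
    proof -
      have "real i * x \<le> real (Suc m) * x" using that \<open>x > 0\<close> by (intro mult_right_mono) auto
      then show ?thesis using \<open>x > 0\<close> by (auto simp: t_def field_simps)
    qed
    have "\<bar>(\<Sum>i<j. f (t m i) * (G (t m (Suc i)) - G (t m i))) - H (t m j)\<bar> \<le> e * t m j"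
      if "j \<le> Suc m" for j
      using that
    proof (induction j)
      case 0
      then show ?case by (simp add: t_def H_def)
    next
      case (Suc j)
      define E where "E y = f (t m j) * G y - H y" for y
      have sub: "{t m j..t m (Suc j)} \<subseteq> {0..x}"
        using t_range[of j] t_range[of "Suc j"] Suc.prems by auto
      have "\<bar>E (t m (Suc j)) - E (t m j)\<bar> \<le> e * (t m (Suc j) - t m j)"
      proof (rule increment_le_within[where f' = "\<lambda>y. (f (t m j) - f y) * g y"])
        fix y assume y: "y \<in> {t m j..t m (Suc j)}"
        have "(H has_real_derivative f y * g y) (at y within {t m j..t m (Suc j)})"
          using y sub by (intro DERIV_subset[OF H']) auto
        then show "(E has_real_derivative (f (t m j) - f y) * g y) (at y within {t m j..t m (Suc j)})"
          unfolding E_def using DERIV_diff[OF DERIV_cmult[OF DERIV_subset[OF G subset_UNIV], of "f (t m j)"]]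
          by (simp add: left_diff_distrib)
      next
        fix y assume y: "y \<in> {t m j<..<t m (Suc j)}"
        have "\<bar>f (t m j) - f y\<bar> < e"
          using y sub t_range[of j] Suc.prems mesh step[of j] by (intro d(2)) auto
        then have "\<bar>f (t m j) - f y\<bar> * \<bar>g y\<bar> \<le> e * 1" using g_le by (intro mult_mono) auto
        then show "\<bar>(f (t m j) - f y) * g y\<bar> \<le> e" by (simp add: abs_mult)
      qed (use step step_pos in simp)
      moreover have "\<bar>(\<Sum>i<j. f (t m i) * (G (t m (Suc i)) - G (t m i))) - H (t m j)\<bar> \<le> e * t m j"
        using Suc by simp
      moreover have "(\<Sum>i<Suc j. f (t m i) * (G (t m (Suc i)) - G (t m i))) - H (t m (Suc j))
          = ((\<Sum>i<j. f (t m i) * (G (t m (Suc i)) - G (t m i))) - H (t m j)) + (E (t m (Suc j)) - E (t m j))"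
        by (simp add: E_def algebra_simps)
      ultimately have "\<bar>(\<Sum>i<Suc j. f (t m i) * (G (t m (Suc i)) - G (t m i))) - H (t m (Suc j))\<bar>
          \<le> e * t m j + e * (t m (Suc j) - t m j)"
        by (simp only:)
      then show ?case by (simp add: right_diff_distrib)
    qed
    from this[of "Suc m"] have "\<bar>(\<Sum>i<Suc m. f (t m i) * (G (t m (Suc i)) - G (t m i))) - H (t m (Suc m))\<bar>
        \<le> e * t m (Suc m)" by simp
    moreover have "t m (Suc m) = x" by (simp add: t_def)
    moreover have "e * x < r" using \<open>r > 0\<close> \<open>x > 0\<close> by (simp add: e_def)
    ultimately show ?thesis by (simp only: H_def)
  qed
  then show "\<exists>N. \<forall>m\<ge>N. norm ((\<Sum>i<Suc m. f (t m i) * (G (t m (Suc i)) - G (t m i)))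
      - integral {0..x} (\<lambda>s. f s * g s)) < r"
    unfolding real_norm_def by blast
qed

text \<open>The gain from oscillation. After summation by parts the Riemann sum is a combination of independent
  centred normal increments with coefficients bounded by \<open>1 / q\<close>, so the exponential
  moments at \<open>\<plusminus>q\<close> are at most \<open>exp (L / 2)\<close>; Fatou's lemma
  passes this to the limit. The conclusion speaks of a measurable majorant \<open>W\<close>, namely
  the lower limit of the discretised quantities, so that measurability of the pathwise integral need
  not be discussed.\<close>

lemma brownian_integral_exp_moment:
  fixes g G :: "real \<Rightarrow> real"
  assumes bm: "standard_brownian_motion_on M L B" and "q > 0" and x: "x \<in> {0<..L}"
    and G: "\<And>s. (G has_real_derivative g s) (at s)" and g: "continuous_on UNIV g" "\<And>s. \<bar>g s\<bar> \<le> 1"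
    and G_le: "\<And>s. \<bar>G s\<bar> \<le> 1 / (2 * q)"
  obtains W where "W \<in> borel_measurable M" "(\<integral>\<^sup>+\<omega>. W \<omega> \<partial>M) \<le> ennreal (2 * exp (L / 2))"
    "\<And>\<omega>. B 0 \<omega> = 0 \<Longrightarrow> continuous_on {0..L} (\<lambda>x. B x \<omega>) \<Longrightarrow>
      ennreal (exp (q * \<bar>integral {0..x} (\<lambda>s. B s \<omega> * g s)\<bar>)) \<le> W \<omega>"
proof -
  define t where "t m i = real i * x / real (Suc m)" for m i
  define V where "V m \<omega> = (\<Sum>i<Suc m. (G (t m (Suc m)) - G (t m (Suc i))) * (B (t m (Suc i)) \<omega> - B (t m i) \<omega>))"
    for m \<omega>
  have t_range: "t m i \<in> {0..L}" if "i \<le> Suc m" for m i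
  proof -
    have "real i * x \<le> real (Suc m) * L" using that x by (intro mult_mono) auto
    then show ?thesis using x by (auto simp: t_def field_simps)
  qed
  have t_less: "t m i < t m (Suc i)" for m i
    using x by (simp add: t_def divide_strict_right_mono)
  have B_meas: "B (t m i) \<in> borel_measurable M" if "i \<le> Suc m" for m i
    using bm t_range[OF that] by (auto simp: standard_brownian_motion_on_def)
  have V_meas: "V m \<in> borel_measurable M" for m
    unfolding V_def by (intro borel_measurable_sum borel_measurable_times borel_measurable_diff
        borel_measurable_const B_meas) auto
  have signed: "(\<integral>\<^sup>+\<omega>. ennreal (exp (a * V m \<omega>)) \<partial>M) \<le> ennreal (exp (L / 2))" if "\<bar>a\<bar> = q" for a m
  proof -
    \<comment> \<open>Each coefficient is at most \<open>1\<close> in absolute value, because \<open>\<bar>G\<bar> \<le> 1 / (2 q)\<close>.\<close>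
    define c where "c i = a * (G (t m (Suc m)) - G (t m (Suc i)))" for i
    have "(\<integral>\<^sup>+\<omega>. ennreal (exp (a * V m \<omega>)) \<partial>M)
        = (\<integral>\<^sup>+\<omega>. ennreal (exp (\<Sum>i<Suc m. c i * (B (t m (Suc i)) \<omega> - B (t m i) \<omega>))) \<partial>M)"
      unfolding V_def c_def sum_distrib_left mult.assoc ..
    also have "\<dots> = ennreal (exp (\<Sum>i<Suc m. (c i)\<^sup>2 * (t m (Suc i) - t m i) / 2))"
      by (rule brownian_increments_exp_moment[OF bm]) (use t_range t_less in auto)
    also have "\<dots> \<le> ennreal (exp (L / 2))"
    proof (rule ennreal_leI, rule exp_le_cancel_iff[THEN iffD2])
      have "(\<Sum>i<Suc m. (c i)\<^sup>2 * (t m (Suc i) - t m i) / 2) \<le> (\<Sum>i<Suc m. 1 * (t m (Suc i) - t m i) / 2)"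
      proof (intro sum_mono divide_right_mono mult_right_mono)
        fix i
        have "\<bar>G (t m (Suc m)) - G (t m (Suc i))\<bar> \<le> 1 / (2 * q) + 1 / (2 * q)"
          by (rule order_trans[OF abs_triangle_ineq4 add_mono[OF G_le G_le]])
        then have "q * \<bar>G (t m (Suc m)) - G (t m (Suc i))\<bar> \<le> q * (1 / (2 * q) + 1 / (2 * q))"
          using \<open>q > 0\<close> by (intro mult_left_mono) auto
        then have "\<bar>c i\<bar> \<le> 1" using \<open>q > 0\<close> that by (simp add: c_def abs_mult)
        then show "(c i)\<^sup>2 \<le> 1" by (simp add: abs_square_le_1)
      qed (use t_less less_imp_le in auto)
      also have "\<dots> = (t m (Suc m) - t m 0) / 2"
        by (simp only: mult_1_left sum_lessThan_telescope flip: sum_divide_distrib)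
      also have "\<dots> \<le> L / 2" using t_range[of "Suc m" m] by (simp add: t_def)
      finally show "(\<Sum>i<Suc m. (c i)\<^sup>2 * (t m (Suc i) - t m i) / 2) \<le> L / 2" .
    qed
    finally show ?thesis .
  qed
  have exp_meas: "(\<lambda>\<omega>. ennreal (exp (a * V m \<omega>))) \<in> borel_measurable M" for a m
    using V_meas[of m] by measurable
  define w where "w m \<omega> = ennreal (exp (q * \<bar>V m \<omega>\<bar>))" for m \<omega>
  have w_meas: "w m \<in> borel_measurable M" for m
    unfolding w_def using V_meas[of m] by measurable
  have w_int: "(\<integral>\<^sup>+\<omega>. w m \<omega> \<partial>M) \<le> ennreal (2 * exp (L / 2))" for m
  proof -
    have "(\<integral>\<^sup>+\<omega>. w m \<omega> \<partial>M)
        \<le> (\<integral>\<^sup>+\<omega>. ennreal (exp (q * V m \<omega>)) + ennreal (exp (- q * V m \<omega>)) \<partial>M)"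
      unfolding w_def by (intro nn_integral_mono) (auto simp: abs_if)
    also have "\<dots> = (\<integral>\<^sup>+\<omega>. ennreal (exp (q * V m \<omega>)) \<partial>M) + (\<integral>\<^sup>+\<omega>. ennreal (exp (- q * V m \<omega>)) \<partial>M)"
      by (intro nn_integral_add exp_meas)
    also have "\<dots> \<le> ennreal (exp (L / 2)) + ennreal (exp (L / 2))"
      using \<open>q > 0\<close> by (intro add_mono signed) auto
    also have "\<dots> = ennreal (2 * exp (L / 2))" by (simp flip: ennreal_plus)
    finally show ?thesis .
  qed
  show ?thesis
  proof (rule that[of "\<lambda>\<omega>. liminf (\<lambda>m. w m \<omega>)"])
    show "(\<lambda>\<omega>. liminf (\<lambda>m. w m \<omega>)) \<in> borel_measurable M"
      using w_meas by measurable
    have "(\<integral>\<^sup>+\<omega>. liminf (\<lambda>m. w m \<omega>) \<partial>M) \<le> liminf (\<lambda>m. \<integral>\<^sup>+\<omega>. w m \<omega> \<partial>M)"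
      by (rule nn_integral_liminf[OF w_meas])
    also have "\<dots> \<le> limsup (\<lambda>m. \<integral>\<^sup>+\<omega>. w m \<omega> \<partial>M)"
      by (intro Liminf_le_Limsup) simp
    also have "\<dots> \<le> ennreal (2 * exp (L / 2))"
      by (intro Limsup_bounded always_eventually allI w_int)
    finally show "(\<integral>\<^sup>+\<omega>. liminf (\<lambda>m. w m \<omega>) \<partial>M) \<le> ennreal (2 * exp (L / 2))" .
    fix \<omega> assume B0: "B 0 \<omega> = 0" and cont: "continuous_on {0..L} (\<lambda>x. B x \<omega>)"
    have "(\<lambda>m. \<Sum>i<Suc m. B (t m i) \<omega> * (G (t m (Suc i)) - G (t m i)))
        \<longlonglongrightarrow> integral {0..x} (\<lambda>s. B s \<omega> * g s)"
      unfolding t_def using x g G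
      by (intro riemann_stieltjes_sums_converge continuous_on_subset[OF cont]
          continuous_on_subset[OF g(1)]) auto
    also have "(\<lambda>m. \<Sum>i<Suc m. B (t m i) \<omega> * (G (t m (Suc i)) - G (t m i))) = (\<lambda>m. V m \<omega>)"
    proof
      fix m
      show "(\<Sum>i<Suc m. B (t m i) \<omega> * (G (t m (Suc i)) - G (t m i))) = V m \<omega>"
        using summation_by_parts[of "\<lambda>i. B (t m i) \<omega>" "\<lambda>i. G (t m i)" "Suc m"] B0
        by (simp add: V_def t_def)
    qed
    finally have "(\<lambda>m. w m \<omega>) \<longlonglongrightarrow> ennreal (exp (q * \<bar>integral {0..x} (\<lambda>s. B s \<omega> * g s)\<bar>))"
      unfolding w_def by (intro tendsto_intros)
    then have "liminf (\<lambda>m. w m \<omega>) = ennreal (exp (q * \<bar>integral {0..x} (\<lambda>s. B s \<omega> * g s)\<bar>))"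
      by (intro lim_imp_Liminf) auto
    then show "ennreal (exp (q * \<bar>integral {0..x} (\<lambda>s. B s \<omega> * g s)\<bar>)) \<le> liminf (\<lambda>m. w m \<omega>)" by simp
  qed
qed

text \<open>Two reductions make countably many moment bounds suffice. Between neighbouring nodes
  \<open>j L / n\<close> the integral changes by at most \<open>b L / n\<close>, where
  \<open>b\<close> bounds the path. At the nodes, the sum of all majorants with weights
  \<open>1 / n\<^sup>3\<close> has finite expectation (\<open>n\<close> nodes contribute
  \<open>O(n / n\<^sup>3)\<close>), hence is finite almost surely, and then each majorant is
  \<open>O(n\<^sup>3)\<close>; the exponent is therefore \<open>O(log n)\<close>. This replaces the
  Borel--Cantelli lemma.\<close>

lemma brownian_oscillatory_integrals_AE:
  fixes g G :: "nat \<Rightarrow> real \<Rightarrow> real"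
  assumes bm: "standard_brownian_motion_on M L B" and "L > 0"
    and G: "\<And>n s. (G n has_real_derivative g n s) (at s)"
    and g: "\<And>n. continuous_on UNIV (g n)" "\<And>n s. \<bar>g n s\<bar> \<le> 1"
    and G_le: "\<And>n s. n \<ge> 1 \<Longrightarrow> \<bar>G n s\<bar> \<le> 1 / (2 * (real n * pi / L))"
  shows "AE \<omega> in M. \<exists>C\<ge>0. \<forall>n\<ge>1. \<forall>x\<in>{0..L}.
    \<bar>integral {0..x} (\<lambda>s. B s \<omega> * g n s)\<bar> \<le> C * (1 + ln (real n)) / real n"
proof -
  define K where "K = 2 * exp (L / 2)"
  have "K \<ge> 0" by (simp add: K_def)
  define good where "good \<omega> \<longleftrightarrow> B 0 \<omega> = 0 \<and> continuous_on {0..L} (\<lambda>x. B x \<omega>)" for \<omega>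
  define node where "node n j = real j * L / real n" for n j :: nat
  have "\<exists>W. W \<in> borel_measurable M \<and> (\<integral>\<^sup>+\<omega>. W \<omega> \<partial>M) \<le> ennreal K \<and>
      (\<forall>\<omega>. good \<omega> \<longrightarrow> n \<ge> 1 \<longrightarrow> 1 \<le> j \<longrightarrow> j \<le> n \<longrightarrow>
        ennreal (exp (real n * pi / L * \<bar>integral {0..node n j} (\<lambda>s. B s \<omega> * g n s)\<bar>)) \<le> W \<omega>)" for n j
  proof (cases "n \<ge> 1 \<and> 1 \<le> j \<and> j \<le> n")
    case True
    have "real j * L \<le> real n * L" using True \<open>L > 0\<close> by (intro mult_right_mono) auto
    then have node: "node n j \<in> {0<..L}" using True \<open>L > 0\<close> by (auto simp: node_def field_simps)
    have q: "real n * pi / L > 0" using True \<open>L > 0\<close> by simp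
    obtain W where "W \<in> borel_measurable M" "(\<integral>\<^sup>+\<omega>. W \<omega> \<partial>M) \<le> ennreal (2 * exp (L / 2))"
      "\<And>\<omega>. B 0 \<omega> = 0 \<Longrightarrow> continuous_on {0..L} (\<lambda>x. B x \<omega>) \<Longrightarrow>
        ennreal (exp (real n * pi / L * \<bar>integral {0..node n j} (\<lambda>s. B s \<omega> * g n s)\<bar>)) \<le> W \<omega>"
      by (rule brownian_integral_exp_moment[OF bm q node G g G_le]) (use True that in auto)
    then show ?thesis by (intro exI[of _ W]) (simp add: good_def K_def)
  next
    case False
    then show ?thesis by (intro exI[of _ "\<lambda>_. 0"]) auto
  qed
  then obtain W where W_meas: "\<And>n j. W n j \<in> borel_measurable M"
    and W_int: "\<And>n j. (\<integral>\<^sup>+\<omega>. W n j \<omega> \<partial>M) \<le> ennreal K"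
    and W: "\<And>n j \<omega>. good \<omega> \<Longrightarrow> n \<ge> 1 \<Longrightarrow> 1 \<le> j \<Longrightarrow> j \<le> n \<Longrightarrow>
        ennreal (exp (real n * pi / L * \<bar>integral {0..node n j} (\<lambda>s. B s \<omega> * g n s)\<bar>)) \<le> W n j \<omega>"
    by metis
  define T where "T n \<omega> = (\<Sum>j<n. ennreal (1 / real n ^ 3) * W n (Suc j) \<omega>)" for n \<omega>
  have T_meas: "T n \<in> borel_measurable M" for n
    unfolding T_def using W_meas by measurable
  have T_int: "(\<integral>\<^sup>+\<omega>. T n \<omega> \<partial>M) \<le> ennreal (K * inverse (real n ^ 2))" for n
  proof -
    have "(\<integral>\<^sup>+\<omega>. T n \<omega> \<partial>M) = (\<Sum>j<n. ennreal (1 / real n ^ 3) * (\<integral>\<^sup>+\<omega>. W n (Suc j) \<omega> \<partial>M))"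
      unfolding T_def using W_meas by (simp add: nn_integral_sum nn_integral_cmult)
    also have "\<dots> \<le> (\<Sum>j<n. ennreal (1 / real n ^ 3) * ennreal K)"
      by (intro sum_mono mult_left_mono W_int) auto
    also have "\<dots> = ennreal (\<Sum>j<n. 1 / real n ^ 3 * K)"
    proof -
      have "ennreal (1 / real n ^ 3) * ennreal K = ennreal (1 / real n ^ 3 * K)"
        using \<open>K \<ge> 0\<close> by (intro ennreal_mult[symmetric]) auto
      then show ?thesis using \<open>K \<ge> 0\<close> by (simp only:) (intro sum_ennreal, simp)
    qed
    also have "(\<Sum>j<n. 1 / real n ^ 3 * K) = K * inverse (real n ^ 2)"
      by (cases "n = 0") (simp_all add: field_simps power2_eq_square power3_eq_cube)
    finally show ?thesis .
  qed
  have "summable (\<lambda>n. K * inverse (real n ^ 2))"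
    by (intro summable_mult inverse_power_summable) simp
  then have fin: "(\<Sum>n. ennreal (K * inverse (real n ^ 2))) \<noteq> top"
    by (rule ennreal_suminf_neq_top) (use \<open>K \<ge> 0\<close> in simp)
  have "(\<integral>\<^sup>+\<omega>. (\<Sum>n. T n \<omega>) \<partial>M) = (\<Sum>n. \<integral>\<^sup>+\<omega>. T n \<omega> \<partial>M)"
    by (rule nn_integral_suminf[OF T_meas])
  also have "\<dots> \<le> (\<Sum>n. ennreal (K * inverse (real n ^ 2)))"
    by (intro suminf_le T_int) auto
  finally have "(\<integral>\<^sup>+\<omega>. (\<Sum>n. T n \<omega>) \<partial>M) \<noteq> \<infinity>"
    using neq_top_trans[OF fin] by (simp only: infinity_ennreal_def not_False_eq_True)
  then have "AE \<omega> in M. (\<Sum>n. T n \<omega>) \<noteq> \<infinity>"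
    using T_meas by (intro nn_integral_PInf_AE) measurable
  moreover have "AE \<omega> in M. B 0 \<omega> = 0" "AE \<omega> in M. continuous_on {0..L} (\<lambda>x. B x \<omega>)"
    using bm by (auto simp: standard_brownian_motion_on_def)
  ultimately show ?thesis
  proof eventually_elim
    case (elim \<omega>)
    then have "good \<omega>" by (simp add: good_def)
    obtain s0 where s0: "(\<Sum>n. T n \<omega>) = ennreal s0" "s0 \<ge> 0"
      using elim(1) by (cases "\<Sum>n. T n \<omega>") auto
    \<comment> \<open>The shift by \<open>1\<close> only ensures that the logarithm of \<open>s\<close> makes sense.\<close>
    define s where "s = s0 + 1"
    have "s > 0" using s0 by (simp add: s_def)
    obtain b where b: "b \<ge> 0" "\<And>x. x \<in> {0..L} \<Longrightarrow> \<bar>B x \<omega>\<bar> \<le> b"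
      using continuous_bounded[OF elim(3)] by blast
    define C where "C = L / pi * (\<bar>ln s\<bar> + 3) + b * L"
    have C1: "L / pi * (\<bar>ln s\<bar> + 3) \<ge> 0" using \<open>L > 0\<close> by simp
    then have "C \<ge> 0" using b \<open>L > 0\<close> by (simp add: C_def)
    have "\<bar>integral {0..x} (\<lambda>s. B s \<omega> * g n s)\<bar> \<le> C * (1 + ln (real n)) / real n"
      if "n \<ge> 1" and x: "x \<in> {0..L}" for n x
    proof -
      define H where "H y = integral {0..y} (\<lambda>s. B s \<omega> * g n s)" for y
      have H': "(H has_real_derivative B y \<omega> * g n y) (at y within {0..L})" if "y \<in> {0..L}" for y
        unfolding H_def
        by (intro integral_has_real_derivative continuous_intros elim(3) that
            continuous_on_subset[OF g(1)]) auto
      have ln_nonneg: "ln (real n) \<ge> 0" using \<open>n \<ge> 1\<close> by simp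
      have at_nodes: "\<bar>H (node n j)\<bar> \<le> L / pi * (\<bar>ln s\<bar> + 3) * (1 + ln (real n)) / real n" if "j \<le> n" for j
      proof (cases "j = 0")
        case True
        then show ?thesis using \<open>L > 0\<close> ln_nonneg
          by (auto simp: H_def node_def intro!: divide_nonneg_nonneg mult_nonneg_nonneg)
      next
        case False
        define Z where "Z = real n * pi / L * \<bar>H (node n j)\<bar>"
        have "ennreal (1 / real n ^ 3) * W n j \<omega> \<le> T n \<omega>"
          unfolding T_def
          using member_le_sum[of "j - 1" "{..<n}" "\<lambda>j. ennreal (1 / real n ^ 3) * W n (Suc j) \<omega>"]
            False that by auto
        also have "T n \<omega> \<le> (\<Sum>n. T n \<omega>)"
          using sum_le_suminf[of "\<lambda>n. T n \<omega>" "{n}"] by simp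
        also have "\<dots> \<le> ennreal s" by (simp add: s0 s_def)
        finally have "ennreal (1 / real n ^ 3) * W n j \<omega> \<le> ennreal s" .
        moreover have "ennreal (exp Z) \<le> W n j \<omega>"
          unfolding Z_def H_def using False that \<open>n \<ge> 1\<close> by (intro W \<open>good \<omega>\<close>) auto
        ultimately have "ennreal (1 / real n ^ 3) * ennreal (exp Z) \<le> ennreal s"
          by (meson mult_left_mono order_trans zero_le)
        then have "1 / real n ^ 3 * exp Z \<le> s"
          using \<open>s > 0\<close> by (simp flip: ennreal_mult)
        then have "exp Z \<le> s * real n ^ 3" using \<open>n \<ge> 1\<close> by (simp add: field_simps)
        then have "Z \<le> ln (s * real n ^ 3)"
          using \<open>s > 0\<close> \<open>n \<ge> 1\<close> by (subst ln_ge_iff) auto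
        also have "\<dots> = ln s + 3 * ln (real n)"
          using \<open>s > 0\<close> \<open>n \<ge> 1\<close> by (simp add: ln_mult ln_realpow)
        also have "\<dots> \<le> (\<bar>ln s\<bar> + 3) * (1 + ln (real n))"
        proof -
          have "ln s \<le> \<bar>ln s\<bar>" "0 \<le> \<bar>ln s\<bar> * ln (real n)" using ln_nonneg by auto
          then show ?thesis by (simp add: algebra_simps)
        qed
        finally have "real n * pi / L * \<bar>H (node n j)\<bar> \<le> (\<bar>ln s\<bar> + 3) * (1 + ln (real n))"
          by (simp add: Z_def)
        then show ?thesis using \<open>L > 0\<close> \<open>n \<ge> 1\<close> by (simp add: field_simps)
      qed
      define j where "j = nat \<lfloor>x * real n / L\<rfloor>"
      have "x * real n / L \<ge> 0" using x \<open>L > 0\<close> by simp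
      then have j: "real j \<le> x * real n / L" "x * real n / L < real j + 1"
        unfolding j_def by linarith+
      have node_le: "node n j \<le> x" and "node n j \<ge> 0" and "x \<le> (real j + 1) * L / real n"
        using j \<open>L > 0\<close> \<open>n \<ge> 1\<close> by (auto simp: node_def field_simps)
      then have node_near: "x - node n j \<le> L / real n"
        by (simp add: node_def distrib_right add_divide_distrib)
      have "x * real n / L \<le> real n" using x \<open>L > 0\<close> by (simp add: field_simps mult_right_mono)
      then have "j \<le> n" using j(1) by linarith
      have "\<bar>H x - H (node n j)\<bar> \<le> b * (x - node n j)"
      proof (rule increment_le_within[where f' = "\<lambda>y. B y \<omega> * g n y"])
        fix y assume y: "y \<in> {node n j..x}"
        show "(H has_real_derivative B y \<omega> * g n y) (at y within {node n j..x})"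
          using y x \<open>node n j \<ge> 0\<close> by (intro DERIV_subset[OF H']) auto
      next
        fix y assume y: "y \<in> {node n j<..<x}"
        then have "\<bar>B y \<omega>\<bar> * \<bar>g n y\<bar> \<le> b * 1"
          using x \<open>node n j \<ge> 0\<close> b g(2) by (intro mult_mono) auto
        then show "\<bar>B y \<omega> * g n y\<bar> \<le> b" by (simp add: abs_mult)
      qed (rule node_le)
      also have "\<dots> \<le> b * (L / real n)" by (intro mult_left_mono node_near b)
      also have "\<dots> \<le> b * L * (1 + ln (real n)) / real n"
        using b \<open>L > 0\<close> ln_nonneg by (simp add: distrib_left divide_right_mono)
      finally have "\<bar>H x - H (node n j)\<bar> \<le> b * L * (1 + ln (real n)) / real n" .
      from order_trans[OF abs_triangle_ineq add_mono[OF this at_nodes[OF \<open>j \<le> n\<close>]]]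
      have "\<bar>H x\<bar> \<le> b * L * (1 + ln (real n)) / real n
          + L / pi * (\<bar>ln s\<bar> + 3) * (1 + ln (real n)) / real n" by simp
      also have "\<dots> = C * (1 + ln (real n)) / real n"
        by (simp add: C_def distrib_right add_divide_distrib)
      finally show ?thesis by (simp add: H_def)
    qed
    with \<open>C \<ge> 0\<close> show ?case by blast
  qed
qed

section \<open>Eigenvalue asymptotics\<close>

text \<open>The deterministic half of the asymptotics; chance enters later, through \<open>A\<close>. The first
  few eigenvalues may be negative or small. From \<open>w 1 < n \<pi>\<close> on one has
  \<open>\<lambda>\<^sub>n \<ge> 1\<close>, and the rescaled angle with
  \<open>k = sqrt \<lambda>\<^sub>n\<close> is available, which is why the statement is about all
  large \<open>n\<close>.\<close>

lemma dirichlet_wave_numbers_near_free: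
  fixes \<sigma> :: "real \<Rightarrow> real" and A :: "nat \<Rightarrow> real"
  assumes "L > 0" and cont: "continuous_on {0..L} \<sigma>"
    and sin_int: "\<And>n x. n \<ge> 1 \<Longrightarrow> x \<in> {0..L} \<Longrightarrow>
      \<bar>integral {0..x} (\<lambda>s. \<sigma> s * sin (2 * (real n * pi / L) * s))\<bar> \<le> A n"
    and cos_int: "\<And>n x. n \<ge> 1 \<Longrightarrow> x \<in> {0..L} \<Longrightarrow>
      \<bar>integral {0..x} (\<lambda>s. \<sigma> s * cos (2 * (real n * pi / L) * s))\<bar> \<le> A n"
  shows "\<exists>C. \<forall>\<^sub>F n in sequentially. dirichlet_eigenvalue L \<sigma> n \<ge> 1 \<and>
    \<bar>sqrt (dirichlet_eigenvalue L \<sigma> n) - real n * pi / L\<bar> \<le> C * (A n + 1 / real n)"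
proof -
  obtain M where M: "\<And>x. x \<in> {0..L} \<Longrightarrow> \<bar>\<sigma> x\<bar> \<le> M" "M \<ge> 0"
    using continuous_bounded[OF cont] by blast
  have "L \<ge> 0" using \<open>L > 0\<close> by simp
  obtain \<Theta> where \<Theta>: "\<And>\<mu>. prufer_angle L \<sigma> \<mu> (\<Theta> \<mu>)"
    using prufer_angle_exists[OF \<open>L \<ge> 0\<close> cont] by metis
  define w where "w \<mu> = \<Theta> \<mu> L" for \<mu>
  have mono: "strict_mono w"
    unfolding w_def by (intro strict_monoI prufer_angle_strict_mono[OF \<open>L > 0\<close> \<Theta> \<Theta> _ M(1)])
  have "w (- M\<^sup>2 - 1) < pi / 2"
    unfolding w_def by (rule prufer_angle_less_pi_half[OF \<open>L > 0\<close> \<Theta> M(1)]) simp_all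
  then have low: "w (- M\<^sup>2 - 1) < pi" using pi_gt_zero by linarith
  obtain l where l: "strict_mono_on {1..} l" "{\<mu>. sin (w \<mu>) = 0} = l ` {1..}"
    "\<And>n::nat. n \<ge> 1 \<Longrightarrow> w (l n) = real n * pi"
  proof (rule enumeration_of_sine_zeros[OF mono _ _ low])
    show "isCont w \<mu>" for \<mu>
      unfolding w_def by (rule prufer_angle_at_endpoint_continuous[OF \<open>L > 0\<close> \<Theta> M])
    show "w \<mu> > 0" for \<mu>
      unfolding w_def using \<open>L > 0\<close> by (intro prufer_angle_pos[OF \<open>L > 0\<close> \<Theta>]) auto
    show "\<exists>\<mu>. w \<mu> > T" for T
    proof -
      have "\<exists>\<mu>. \<forall>\<theta>. prufer_angle L \<sigma> \<mu> \<theta> \<longrightarrow> \<theta> L > T"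
        by (rule prufer_angle_unbounded[OF \<open>L > 0\<close> M])
      then obtain \<mu> where "w \<mu> > T" using \<Theta> unfolding w_def by metis
      then show ?thesis ..
    qed
  qed (rule that)
  have spectrum: "dirichlet_eigenvalues L \<sigma> = l ` {1..}"
    using dirichlet_eigenvalue_iff[OF \<open>L > 0\<close> cont \<Theta>] unfolding l(2)[symmetric] w_def by blast
  have ev: "dirichlet_eigenvalue L \<sigma> n = l n" if "n \<ge> 1" for n
    unfolding dirichlet_eigenvalue_def by (rule nth_smallest_eq[OF l(1) spectrum that])
  define D where "D = M + M\<^sup>2"
  have "D \<ge> 0" using M(2) by (simp add: D_def)
  define C where "C = 1 / L + 8 * D + 2 * M\<^sup>2 * L / pi"
  have close: "l n \<ge> 1 \<and> \<bar>sqrt (l n) - real n * pi / L\<bar> \<le> C * (A n + 1 / real n)"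
    if n: "n \<ge> 1" "real n * pi > w 1" "real n * pi / L \<ge> 2 * D" for n :: nat
  proof
    define q where "q = real n * pi / L"
    define k where "k = sqrt (l n)"
    have "q > 0" using n \<open>L > 0\<close> by (simp add: q_def)
    have "w 1 < w (l n)" using n l(3) by simp
    then show "l n \<ge> 1" using mono by (simp add: strict_mono_less)
    then have k2: "k\<^sup>2 = l n" and "k \<ge> 1" by (simp_all add: k_def)
    have A: "\<bar>integral {0..x} (\<lambda>s. \<sigma> s * sin (2 * q * s))\<bar> \<le> A n"
      "\<bar>integral {0..x} (\<lambda>s. \<sigma> s * cos (2 * q * s))\<bar> \<le> A n" if "x \<in> {0..L}" for x
      unfolding q_def using n(1) that by (intro sin_int cos_int; simp)+
    have "A n \<ge> 0" using A(1)[of 0] \<open>L > 0\<close> by simp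
    have angle: "prufer_angle L \<sigma> (k\<^sup>2) (\<Theta> (l n))" "\<Theta> (l n) L = real n * pi"
      using \<Theta>[of "l n"] l(3)[OF n(1)] by (simp_all add: k2 w_def)
    note est = wave_number_estimate[OF \<open>L > 0\<close> angle(1) \<open>k \<ge> 1\<close> angle(2) cont M q_def A]
    have "\<bar>k - q\<bar> \<le> D" unfolding D_def by (rule est(1))
    \<comment> \<open>The a priori bound \<open>\<bar>k - q\<bar> \<le> D \<le> q / 2\<close> turns \<open>1 / k\<close> into \<open>O(1 / n)\<close>.\<close>
    then have "k \<ge> q / 2" using n(3) unfolding q_def[symmetric] by linarith
    have "M\<^sup>2 / k \<le> M\<^sup>2 / (q / 2)"
      using \<open>k \<ge> q / 2\<close> \<open>q > 0\<close> by (intro divide_left_mono mult_pos_pos) auto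
    also have "\<dots> = 2 * M\<^sup>2 * L / pi * (1 / real n)"
      using \<open>L > 0\<close> by (simp add: q_def field_simps)
    finally have Mk: "M\<^sup>2 / k \<le> 2 * M\<^sup>2 * L / pi * (1 / real n)" .
    have "\<bar>k - q\<bar> * L \<le> A n + (M\<^sup>2 / k + 8 * A n * D) * L" unfolding D_def by (rule est(2))
    then have "\<bar>k - q\<bar> \<le> A n / L + M\<^sup>2 / k + 8 * A n * D"
      using \<open>L > 0\<close> by (simp add: field_simps)
    also have "\<dots> \<le> A n / L + 2 * M\<^sup>2 * L / pi * (1 / real n) + 8 * A n * D"
      using Mk by simp
    also have "\<dots> \<le> C * (A n + 1 / real n)"
    proof -
      have "0 \<le> 2 * M\<^sup>2 * L / pi * A n" "0 \<le> (1 / L + 8 * D) * (1 / real n)"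
        using \<open>A n \<ge> 0\<close> \<open>L > 0\<close> \<open>D \<ge> 0\<close> by simp_all
      then show ?thesis unfolding C_def by (simp only: distrib_left distrib_right) simp
    qed
    finally show "\<bar>sqrt (l n) - real n * pi / L\<bar> \<le> C * (A n + 1 / real n)"
      by (simp add: k_def q_def)
  qed
  have "\<forall>\<^sub>F n in sequentially. real n * pi > w 1" "\<forall>\<^sub>F n in sequentially. real n * pi / L \<ge> 2 * D"
    using \<open>L > 0\<close> by real_asymp+
  with eventually_ge_at_top[of "1 :: nat"]
  have "\<forall>\<^sub>F n in sequentially. dirichlet_eigenvalue L \<sigma> n \<ge> 1 \<and>
      \<bar>sqrt (dirichlet_eigenvalue L \<sigma> n) - real n * pi / L\<bar> \<le> C * (A n + 1 / real n)"
    by eventually_elim (simp add: ev close)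
  then show ?thesis by blast
qed

text \<open>The logarithm in the remainder comes from the union bound over the nodes and the values of
  \<open>n\<close>; each single integral is of order \<open>1 / n\<close>.\<close>

lemma dirichlet_wave_numbers_AE:
  assumes "L > 0" and bm: "standard_brownian_motion_on M L B"
  shows "AE \<omega> in M.
    (\<forall>\<^sub>F n in sequentially. dirichlet_eigenvalue L (\<lambda>x. \<rho> * B x \<omega>) n \<ge> 1) \<and>
    (\<lambda>n. sqrt (dirichlet_eigenvalue L (\<lambda>x. \<rho> * B x \<omega>) n) - real n * pi / L)
      \<in> O(\<lambda>n. (1 + ln (real n)) / real n)"
proof -
  define q where "q n = real n * pi / L" for n :: nat
  have sin_AE: "AE \<omega> in M. \<exists>C\<ge>0. \<forall>n\<ge>1. \<forall>x\<in>{0..L}.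
      \<bar>integral {0..x} (\<lambda>s. B s \<omega> * sin (2 * q n * s))\<bar> \<le> C * (1 + ln (real n)) / real n"
  proof (rule brownian_oscillatory_integrals_AE[OF bm \<open>L > 0\<close>,
        where G = "\<lambda>n s. if n = 0 then 0 else - cos (2 * q n * s) / (2 * q n)"])
    fix n :: nat and s :: real
    show "((\<lambda>s. if n = 0 then 0 else - cos (2 * q n * s) / (2 * q n)) has_real_derivative
        sin (2 * q n * s)) (at s)"
      using \<open>L > 0\<close> by (cases "n = 0") (auto intro!: derivative_eq_intros simp: q_def)
    show "\<bar>if n = 0 then 0 else - cos (2 * q n * s) / (2 * q n)\<bar> \<le> 1 / (2 * (real n * pi / L))"
      using \<open>L > 0\<close> abs_cos_le_one[of "2 * q n * s"]
      by (auto simp: q_def abs_mult divide_right_mono)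
  qed (auto intro!: continuous_intros)
  have cos_AE: "AE \<omega> in M. \<exists>C\<ge>0. \<forall>n\<ge>1. \<forall>x\<in>{0..L}.
      \<bar>integral {0..x} (\<lambda>s. B s \<omega> * (if n = 0 then 0 else cos (2 * q n * s)))\<bar>
        \<le> C * (1 + ln (real n)) / real n"
  proof (rule brownian_oscillatory_integrals_AE[OF bm \<open>L > 0\<close>,
        where G = "\<lambda>n s. if n = 0 then 0 else sin (2 * q n * s) / (2 * q n)"])
    fix n :: nat and s :: real
    show "((\<lambda>s. if n = 0 then 0 else sin (2 * q n * s) / (2 * q n)) has_real_derivative
        (if n = 0 then 0 else cos (2 * q n * s))) (at s)"
      using \<open>L > 0\<close> by (cases "n = 0") (auto intro!: derivative_eq_intros simp: q_def)
    show "\<bar>if n = 0 then 0 else sin (2 * q n * s) / (2 * q n)\<bar> \<le> 1 / (2 * (real n * pi / L))"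
      using \<open>L > 0\<close> abs_sin_le_one[of "2 * q n * s"]
      by (auto simp: q_def abs_mult divide_right_mono)
    show "continuous_on UNIV (\<lambda>s. if n = 0 then 0 else cos (2 * q n * s))"
      by (cases "n = 0") (auto intro!: continuous_intros)
  qed auto
  have cont_AE: "AE \<omega> in M. continuous_on {0..L} (\<lambda>x. B x \<omega>)"
    using bm by (simp add: standard_brownian_motion_on_def)
  from sin_AE cos_AE cont_AE show ?thesis
  proof eventually_elim
    case (elim \<omega>)
    obtain C1 where C1: "C1 \<ge> 0" "\<And>n x. n \<ge> 1 \<Longrightarrow> x \<in> {0..L} \<Longrightarrow>
        \<bar>integral {0..x} (\<lambda>s. B s \<omega> * sin (2 * q n * s))\<bar> \<le> C1 * (1 + ln (real n)) / real n"
      using elim(1) by blast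
    obtain C2 where C2: "C2 \<ge> 0" "\<And>n x. n \<ge> 1 \<Longrightarrow> x \<in> {0..L} \<Longrightarrow>
        \<bar>integral {0..x} (\<lambda>s. B s \<omega> * cos (2 * q n * s))\<bar> \<le> C2 * (1 + ln (real n)) / real n"
      using elim(2) by fastforce
    define \<sigma> where "\<sigma> x = \<rho> * B x \<omega>" for x
    define A where "A n = \<bar>\<rho>\<bar> * ((C1 + C2) * (1 + ln (real n)) / real n)" for n :: nat
    have scale: "\<bar>integral {0..x} (\<lambda>s. \<sigma> s * h s)\<bar> \<le> A n"
      if "n \<ge> 1" "\<bar>integral {0..x} (\<lambda>s. B s \<omega> * h s)\<bar> \<le> C * (1 + ln (real n)) / real n" "C \<le> C1 + C2"
      for h n x C
    proof -
      have "integral {0..x} (\<lambda>s. \<sigma> s * h s) = \<rho> * integral {0..x} (\<lambda>s. B s \<omega> * h s)"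
        by (simp add: \<sigma>_def mult.assoc)
      moreover have "C * (1 + ln (real n)) / real n \<le> (C1 + C2) * (1 + ln (real n)) / real n"
        using that by (intro divide_right_mono mult_right_mono) auto
      ultimately show ?thesis
        using that(2) unfolding A_def by (simp only: abs_mult) (intro mult_left_mono, auto)
    qed
    have "continuous_on {0..L} \<sigma>" unfolding \<sigma>_def by (intro continuous_intros elim(3))
    then have "\<exists>C. \<forall>\<^sub>F n in sequentially. dirichlet_eigenvalue L \<sigma> n \<ge> 1 \<and>
        \<bar>sqrt (dirichlet_eigenvalue L \<sigma> n) - real n * pi / L\<bar> \<le> C * (A n + 1 / real n)"
    proof (rule dirichlet_wave_numbers_near_free[OF \<open>L > 0\<close>])
      fix n :: nat and x :: real assume "n \<ge> 1" "x \<in> {0..L}"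
      then show "\<bar>integral {0..x} (\<lambda>s. \<sigma> s * sin (2 * (real n * pi / L) * s))\<bar> \<le> A n"
        "\<bar>integral {0..x} (\<lambda>s. \<sigma> s * cos (2 * (real n * pi / L) * s))\<bar> \<le> A n"
        using scale[OF _ C1(2), of n x] scale[OF _ C2(2), of n x] C1(1) C2(1) by (simp_all add: q_def)
    qed
    then obtain C where C: "\<forall>\<^sub>F n in sequentially. dirichlet_eigenvalue L \<sigma> n \<ge> 1 \<and>
        \<bar>sqrt (dirichlet_eigenvalue L \<sigma> n) - real n * pi / L\<bar> \<le> C * (A n + 1 / real n)" by blast
    define E where "E = \<bar>\<rho>\<bar> * (C1 + C2)"
    have "(\<lambda>n. sqrt (dirichlet_eigenvalue L \<sigma> n) - real n * pi / L) \<in> O(\<lambda>n. C * (A n + 1 / real n))"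
      by (rule bigoI[where c = 1], use C in eventually_elim) auto
    also have "(\<lambda>n. C * (A n + 1 / real n)) = (\<lambda>n. C * (E * ((1 + ln (real n)) / real n) + 1 / real n))"
      by (simp add: A_def E_def mult.assoc)
    also have "(\<lambda>n. C * (E * ((1 + ln (real n)) / real n) + 1 / real n)) \<in> O(\<lambda>n. (1 + ln (real n)) / real n)"
    proof -
      have "(\<lambda>n. 1 / real n) \<in> O(\<lambda>n. (1 + ln (real n)) / real n)" by real_asymp
      moreover have "(\<lambda>n. E * ((1 + ln (real n)) / real n)) \<in> O(\<lambda>n. (1 + ln (real n)) / real n)"
      proof (cases "E = 0")
        case False
        then show ?thesis by (subst landau_o.big.cmult_in_iff) auto
      qed simp
      ultimately have bound: "(\<lambda>n. E * ((1 + ln (real n)) / real n) + 1 / real n)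
          \<in> O(\<lambda>n. (1 + ln (real n)) / real n)"
        by (intro sum_in_bigo)
      show ?thesis
      proof (cases "C = 0")
        case False
        then show ?thesis using bound by (subst landau_o.big.cmult_in_iff) auto
      qed simp
    qed
    finally show ?case using C by (auto simp: \<sigma>_def[abs_def] elim: eventually_mono)
  qed
qed

theorem corollary1p2:
  fixes M :: "'a measure" and B :: "real \<Rightarrow> 'a \<Rightarrow> real" and L \<rho> :: real
    and lam k :: "nat \<Rightarrow> 'a \<Rightarrow> real"
  assumes "L > 0"
    and "standard_brownian_motion_on M L B"
    and "\<And>n \<omega>. lam n \<omega> = dirichlet_eigenvalue L (\<lambda>x. \<rho> * B x \<omega>) n"
    and "\<And>n \<omega>. k n \<omega> = sqrt (max (lam n \<omega>) 0)"
  shows "(\<forall>\<epsilon>>0. AE \<omega> in M.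
            (\<lambda>n. k n \<omega> - real n * pi / L) \<in> O(\<lambda>n. real n powr (-1 + \<epsilon>))) \<and>
         (\<forall>\<epsilon>>0. AE \<omega> in M.
            (\<lambda>n. lam n \<omega> - (real n * pi / L)\<^sup>2) \<in> O(\<lambda>n. real n powr \<epsilon>))"
proof -
  have base: "AE \<omega> in M. (\<forall>\<^sub>F n in sequentially. lam n \<omega> \<ge> 1) \<and>
      (\<lambda>n. k n \<omega> - real n * pi / L) \<in> O(\<lambda>n. (1 + ln (real n)) / real n)"
    using dirichlet_wave_numbers_AE[OF assms(1,2), of \<rho>]
  proof eventually_elim
    case (elim \<omega>)
    then have pos: "\<forall>\<^sub>F n in sequentially. lam n \<omega> \<ge> 1" by (simp add: assms(3))
    then have "\<forall>\<^sub>F n in sequentially. sqrt (dirichlet_eigenvalue L (\<lambda>x. \<rho> * B x \<omega>) n) - real n * pi / L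
        = k n \<omega> - real n * pi / L"
      by eventually_elim (simp add: assms(4) assms(3)[symmetric])
    from landau_o.big.in_cong[OF this] elim pos show ?case by blast
  qed
  have k_bound: "AE \<omega> in M. (\<lambda>n. k n \<omega> - real n * pi / L) \<in> O(\<lambda>n. real n powr (-1 + \<epsilon>))"
    if "\<epsilon> > 0" for \<epsilon> :: real
    using base
  proof eventually_elim
    case (elim \<omega>)
    have "(\<lambda>n::nat. (1 + ln (real n)) / real n) \<in> O(\<lambda>n. real n powr (-1 + \<epsilon>))"
      using \<open>\<epsilon> > 0\<close> by real_asymp
    with elim show ?case using landau_o.big_trans by blast
  qed
  moreover have "AE \<omega> in M. (\<lambda>n. lam n \<omega> - (real n * pi / L)\<^sup>2) \<in> O(\<lambda>n. real n powr \<epsilon>)"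
    if "\<epsilon> > 0" for \<epsilon> :: real
    using base
  proof eventually_elim
    case (elim \<omega>)
    define d where "d n = k n \<omega> - real n * pi / L" for n
    have d: "d \<in> O(\<lambda>n. (1 + ln (real n)) / real n)" using elim by (simp add: d_def[abs_def])
    also have "(\<lambda>n::nat. (1 + ln (real n)) / real n) \<in> O(\<lambda>n. real n)" by real_asymp
    finally have "d \<in> O(\<lambda>n. real n)" .
    moreover have "(\<lambda>n::nat. 2 * (real n * pi / L)) \<in> O(\<lambda>n. real n)" using assms(1) by real_asymp
    ultimately have "(\<lambda>n. d n + 2 * (real n * pi / L)) \<in> O(\<lambda>n. real n)" by (rule sum_in_bigo)
    with d have "(\<lambda>n. d n * (d n + 2 * (real n * pi / L))) \<in> O(\<lambda>n. (1 + ln (real n)) / real n * real n)"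
      by (rule landau_o.big.mult)
    also have "(\<lambda>n::nat. (1 + ln (real n)) / real n * real n) \<in> O(\<lambda>n. real n powr \<epsilon>)"
      using \<open>\<epsilon> > 0\<close> by real_asymp
    finally have bound: "(\<lambda>n. d n * (d n + 2 * (real n * pi / L))) \<in> O(\<lambda>n. real n powr \<epsilon>)" .
    have "\<forall>\<^sub>F n in sequentially. d n * (d n + 2 * (real n * pi / L)) = lam n \<omega> - (real n * pi / L)\<^sup>2"
      using conjunct1[OF elim]
    proof eventually_elim
      case (elim n)
      then have "(k n \<omega>)\<^sup>2 = lam n \<omega>" by (simp add: assms(4))
      moreover have "(a - b) * (a - b + 2 * b) = a\<^sup>2 - b\<^sup>2" for a b :: real
        by (simp add: algebra_simps power2_eq_square)
      ultimately show ?case by (simp only: d_def)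
    qed
    from landau_o.big.in_cong[OF this] bound show ?case by blast
  qed
  ultimately show ?thesis by blast
qed

end
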